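(* Every planar graph of girth $5$ has inversion diameter at most $7$, and every planar graph of girth $6$ has inversion diameter at most $5$.
   Context: Graphs are finite and simple. For an oriented graph $\overrightarrow{G}$ and $X\subseteq V(\overrightarrow{G})$, the inversion of $X$ reverses every arc having both endpoints in $X$ (and no other arc). For a (labeled) graph $G$, the inversion distance between two orientations of $G$ is the minimum number of inversions transforming one into the other (equality as labeled oriented graphs), and the inversion diameter of $G$ is the maximum inversion distance over all pairs of orientations of $G$. The girth of a graph is the length of a shortest cycle. *)

theory Defs
  imports "HOL-Analysis.Analysis" "Graph_Theory.Pair_Digraph"
begin

text \<open>
  A finite simple graph is a \<^locale>\<open>pair_graph\<close>: a finite, loop-free, symmetric set of
  pairs, where the undirected edge between \<open>u\<close> and \<open>v\<close> is represented by the two pairs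
  \<open>(u, v)\<close> and \<open>(v, u)\<close>. An oriented graph is a \<^typ>\<open>'a pair_pre_digraph\<close> containing
  exactly one of these two pairs for each edge.
\<close>

definition orientation_of :: "'a pair_pre_digraph \<Rightarrow> 'a pair_pre_digraph \<Rightarrow> bool" where
  "orientation_of G D \<longleftrightarrow>
     pverts D = pverts G \<and> parcs D \<subseteq> parcs G \<and>
     (\<forall>(u, v) \<in> parcs G. (u, v) \<in> parcs D \<longleftrightarrow> (v, u) \<notin> parcs D)"

definition inversion :: "'a set \<Rightarrow> 'a pair_pre_digraph \<Rightarrow> 'a pair_pre_digraph" where
  "inversion X D = D\<lparr>parcs :=
     {(u, v). (u, v) \<in> parcs D \<and> \<not> (u \<in> X \<and> v \<in> X)} \<union>
     {(v, u) | u v. (u, v) \<in> parcs D \<and> u \<in> X \<and> v \<in> X}\<rparr>"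

text \<open>
  The values lie in \<^typ>\<open>enat\<close>, so that the infimum is the minimum whenever some sequence of
  inversions exists, and \<open>\<infinity>\<close> otherwise.
\<close>

definition inversion_distance :: "'a pair_pre_digraph \<Rightarrow> 'a pair_pre_digraph \<Rightarrow> enat" where
  "inversion_distance D D' =
     Inf {enat (length Xs) | Xs. (\<forall>X \<in> set Xs. X \<subseteq> pverts D) \<and> fold inversion Xs D = D'}"

definition inversion_diameter :: "'a pair_pre_digraph \<Rightarrow> enat" where
  "inversion_diameter G =
     Sup {inversion_distance D D' | D D'. orientation_of G D \<and> orientation_of G D'}"

text \<open>
  The library's \<^const>\<open>pre_digraph.cycle\<close> is directed, so traversing an edge back and forth is
  one of length 2; the cycles of the undirected graph are those of length at least 3.
  The girth of a forest is \<open>\<infinity>\<close>.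
\<close>

definition girth :: "'a pair_pre_digraph \<Rightarrow> enat" where
  "girth G = Inf {enat (length p) | p. pre_digraph.cycle (with_proj G) p \<and> 3 \<le> length p}"

text \<open>
  Drawings in the plane: distinct vertices are distinct points, every edge is a simple arc between
  its ends (the two pairs representing an edge give the same arc, traversed in opposite
  directions) passing through no other vertex, and distinct edges meet only in common ends.
\<close>

definition plane_drawing ::
    "'a pair_pre_digraph \<Rightarrow> ('a \<Rightarrow> complex) \<Rightarrow> ('a \<times> 'a \<Rightarrow> real \<Rightarrow> complex) \<Rightarrow> bool" where
  "plane_drawing G pos \<gamma> \<longleftrightarrow>
     inj_on pos (pverts G) \<and>
     (\<forall>(u, v) \<in> parcs G.
        arc (\<gamma> (u, v)) \<and> pathstart (\<gamma> (u, v)) = pos u \<and> pathfinish (\<gamma> (u, v)) = pos v \<and>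
        \<gamma> (v, u) = reversepath (\<gamma> (u, v))) \<and>
     (\<forall>(u, v) \<in> parcs G. \<forall>w \<in> pverts G. pos w \<in> path_image (\<gamma> (u, v)) \<longrightarrow> w = u \<or> w = v) \<and>
     (\<forall>(u, v) \<in> parcs G. \<forall>(x, y) \<in> parcs G. {u, v} \<noteq> {x, y} \<longrightarrow>
        path_image (\<gamma> (u, v)) \<inter> path_image (\<gamma> (x, y)) \<subseteq> pos ` ({u, v} \<inter> {x, y}))"

definition planar :: "'a pair_pre_digraph \<Rightarrow> bool" where
  "planar G \<longleftrightarrow> (\<exists>pos \<gamma>. plane_drawing G pos \<gamma>)"

end

theory Submission
  imports Defs
begin

text \<open>
  Two orientations of \<open>G\<close> are at inversion distance at most \<open>k\<close> iff the vertices carry vectors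
  over the field with two elements, of length \<open>k\<close>, such that the product of the vectors at the ends of an
  edge is 1 exactly when the edge has to be reversed. In an edge-minimal graph without such
  vectors (all nonzero), no vertex \<open>u\<close> of degree \<open>d\<close> has \<open>t \<ge> 1\<close> neighbours of degree at most 3 with
  \<open>2^k > 2^(d-t) (1 + 3t)\<close>: after deleting the edges to these neighbours, the vector at \<open>u\<close> can be chosen
  anew outside the spans of the vectors around them, after which their own vectors can be
  chosen anew. Discharging then contradicts the edge bound \<open>m < 5n/3\<close> (girth 5) or
  \<open>m < 3n/2\<close> (girth 6).

  The edge bound needs Euler's inequality for topological drawings. Adding an arc that joins two
  points of the drawing already connected in it increases the number of complementary
  components, by the Jordan curve theorem. Each edge borders at most two faces; this
  follows from Eilenberg's criterion, by which points are separated by a compact set \<open>K\<close> iff \<open>(w - x) / (w - y)\<close>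
  has no continuous logarithm on \<open>K\<close>. The edges bordering a face contain a cycle, as the complement of
  a forest is connected by Janiszewski's theorem.
\<close>

section \<open>Continuous logarithms and separation of the plane\<close>

definition has_log_on :: "complex set \<Rightarrow> (complex \<Rightarrow> complex) \<Rightarrow> bool" where
  "has_log_on K f \<longleftrightarrow> (\<exists>h. continuous_on K h \<and> (\<forall>w\<in>K. f w = exp (h w)))"

lemma has_log_on_mult:
  assumes "has_log_on K f" "has_log_on K g"
  shows "has_log_on K (\<lambda>w. f w * g w)"
proof -
  obtain h k where "continuous_on K h" "\<forall>w\<in>K. f w = exp (h w)"
      "continuous_on K k" "\<forall>w\<in>K. g w = exp (k w)"
    using assms unfolding has_log_on_def by blast
  then show ?thesis
    unfolding has_log_on_def
    by (intro exI[of _ "\<lambda>w. h w + k w"]) (auto intro: continuous_intros simp: exp_add)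
qed

lemma has_log_on_inverse:
  assumes "has_log_on K f"
  shows "has_log_on K (\<lambda>w. inverse (f w))"
proof -
  obtain h where "continuous_on K h" "\<forall>w\<in>K. f w = exp (h w)"
    using assms unfolding has_log_on_def by blast
  then show ?thesis
    unfolding has_log_on_def
    by (intro exI[of _ "\<lambda>w. - h w"]) (auto intro: continuous_intros simp: exp_minus)
qed

lemma has_log_on_cong:
  assumes "has_log_on K f" "\<And>w. w \<in> K \<Longrightarrow> g w = f w"
  shows "has_log_on K g"
  using assms unfolding has_log_on_def by auto

text \<open>One half of Eilenberg's criterion. That \<open>(w - a) / (w - b)\<close> has a logarithm
  on \<open>K\<close> is an equivalence relation between points \<open>a\<close> and
  \<open>b\<close> of the component \<open>C\<close>. Nearby points are related, because the
  quotient then has positive real part on \<open>K\<close> and the principal branch applies. As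
  \<open>C\<close> is connected, there is only one class.\<close>

lemma has_log_on_quotient:
  assumes K: "compact K" and xy: "connected_component (- K) x y"
  shows "has_log_on K (\<lambda>w. (w - x) / (w - y))"
proof -
  define C where "C = connected_component_set (- K) x"
  have CK: "C \<subseteq> - K" unfolding C_def by (rule connected_component_subset)
  have oK: "open (- K)" using K compact_imp_closed by blast
  have xC: "x \<in> C" and yC: "y \<in> C"
    using xy connected_component_in(1)[OF xy] unfolding C_def by (auto simp: connected_component_refl_eq)
  have sym: "has_log_on K (\<lambda>w. (w - b) / (w - a))" if "has_log_on K (\<lambda>w. (w - a) / (w - b))" for a b
    using has_log_on_inverse[OF that] by simp
  have trans: "has_log_on K (\<lambda>w. (w - a) / (w - c))"
    if "has_log_on K (\<lambda>w. (w - a) / (w - b))" "has_log_on K (\<lambda>w. (w - b) / (w - c))" "b \<in> C" for a b c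
  proof (rule has_log_on_cong[OF has_log_on_mult[OF that(1,2)]])
    fix w assume "w \<in> K"
    then have "w \<noteq> b" using that(3) CK by auto
    then show "(w - a) / (w - c) = (w - a) / (w - b) * ((w - b) / (w - c))" by simp
  qed
  define R where "R a b \<longleftrightarrow> has_log_on K (\<lambda>w. (w - a) / (w - b))" for a b
  have "R x y"
  proof (rule connected_equivalence_relation[of C])
    show "connected C" unfolding C_def by simp
    show "x \<in> C" "y \<in> C" by (fact xC yC)+
    show "R b a" if "R a b" for a b using sym that unfolding R_def by blast
    show "R a c" if "R a b" "R b c" "b \<in> C" for a b c using trans that unfolding R_def by blast
  next
    fix a assume "a \<in> C"
    then obtain r where r: "0 < r" "ball a r \<subseteq> - K"
      using CK oK openE by blast
    have "has_log_on K (\<lambda>w. (w - a) / (w - b))" if b: "b \<in> ball a r" for b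
    proof -
      have nz: "w - a \<noteq> 0" and lt: "cmod ((a - b) / (w - a)) < 1" if "w \<in> K" for w
      proof -
        have "r \<le> dist a w" using r that by force
        moreover have "dist a b < r" using b by simp
        ultimately have "cmod (a - b) < cmod (w - a)" by (simp add: dist_norm norm_minus_commute)
        moreover have "0 < cmod (w - a)"
          using calculation norm_ge_zero[of "a - b"] by linarith
        ultimately show "w - a \<noteq> 0" "cmod ((a - b) / (w - a)) < 1" by (auto simp: norm_divide)
      qed
      have pos: "(w - b) / (w - a) \<notin> \<real>\<^sub>\<le>\<^sub>0" if "w \<in> K" for w
      proof -
        have "(w - b) / (w - a) = 1 + (a - b) / (w - a)"
          using nz[OF that] by (simp add: field_simps)
        then have "0 < Re ((w - b) / (w - a))"
          using lt[OF that] abs_Re_le_cmod[of "(a - b) / (w - a)"] by auto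
        then show ?thesis using complex_nonpos_Reals_iff by auto
      qed
      have "continuous_on K (\<lambda>w. Ln ((w - b) / (w - a)))"
        using pos nz by (intro continuous_on_Ln continuous_intros) auto
      moreover have "(w - b) / (w - a) = exp (Ln ((w - b) / (w - a)))" if "w \<in> K" for w
        using pos[OF that] by (intro exp_Ln[symmetric]) auto
      ultimately have "has_log_on K (\<lambda>w. (w - b) / (w - a))"
        unfolding has_log_on_def by blast
      then show ?thesis by (rule sym)
    qed
    then show "\<exists>T. openin (top_of_set C) T \<and> a \<in> T \<and> (\<forall>x\<in>T. R a x)"
      unfolding R_def using \<open>a \<in> C\<close> r(1) by (intro exI[of _ "C \<inter> ball a r"]) auto
  qed
  then show ?thesis unfolding R_def .
qed

text \<open>The values of \<open>g\<close> differ by multiples of 2 pi i, so they form a discrete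
  set, and a continuous function on a connected set takes only one of them.\<close>

lemma exp_eq_const_imp_constant:
  fixes g :: "real \<Rightarrow> complex"
  assumes "connected S" "continuous_on S g" "\<And>t. t \<in> S \<Longrightarrow> exp (g t) = c" "s \<in> S" "t \<in> S"
  shows "g s = g t"
proof -
  have "g constant_on S"
  proof (rule continuous_discrete_range_constant[OF assms(1,2)])
    fix x assume x: "x \<in> S"
    have "2 * pi \<le> cmod (g y - g x)" if y: "y \<in> S" "g y \<noteq> g x" for y
    proof (rule ccontr)
      assume "\<not> 2 * pi \<le> cmod (g y - g x)"
      then have "\<bar>Im (g y) - Im (g x)\<bar> < 2 * pi"
        using abs_Im_le_cmod[of "g y - g x"] by simp
      moreover have "exp (g y) = exp (g x)" using assms(3)[OF x] assms(3)[OF y(1)] by simp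
      ultimately have "g y = g x" by (rule exp_complex_eqI)
      then show False using y by simp
    qed
    then show "\<exists>e>0. \<forall>y. y \<in> S \<and> g y \<noteq> g x \<longrightarrow> e \<le> cmod (g y - g x)"
      by (intro exI[of _ "2 * pi"]) auto
  qed
  then show ?thesis using assms(4,5) unfolding constant_on_def by auto
qed

text \<open>Along the parametrised circle, the logarithm minus i m t has constant exponential and is
  therefore constant. A full turn returns to the same point but changes i m t by 2 pi i m.\<close>

lemma not_has_log_on_circle:
  assumes "0 < r" "has_log_on (sphere x r) (\<lambda>w. (w - x) powi m)"
  shows "m = 0"
proof -
  obtain l where l: "continuous_on (sphere x r) l" "\<And>w. w \<in> sphere x r \<Longrightarrow> (w - x) powi m = exp (l w)"
    using assms(2) unfolding has_log_on_def by blast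
  define c where "c t = x + of_real r * exp (\<i> * of_real t)" for t :: real
  have c: "c t \<in> sphere x r" for t
    using assms(1) by (simp add: c_def dist_norm norm_mult)
  define g where "g t = l (c t) - of_int m * (\<i> * of_real t)" for t :: real
  have "g 0 = g (2 * pi)"
  proof (rule exp_eq_const_imp_constant[of "{0..2*pi}" g "of_real r powi m"])
    have "continuous_on {0..2*pi} (\<lambda>t. l (c t))"
      by (rule continuous_on_compose2[OF l(1)]) (use c in \<open>auto simp: c_def intro!: continuous_intros\<close>)
    then show "continuous_on {0..2*pi} g" unfolding g_def by (intro continuous_intros)
    fix t
    have "exp (g t) = (c t - x) powi m / exp (of_int m * (\<i> * of_real t))"
      using l(2)[OF c] by (simp add: g_def exp_diff)
    also have "\<dots> = of_real r powi m"
      by (simp add: c_def power_int_mult_distrib exp_power_int)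
    finally show "exp (g t) = of_real r powi m" .
  qed auto
  moreover have "c 0 = c (2 * pi)"
    by (simp add: c_def) (metis exp_two_pi_i mult.commute)
  ultimately show "m = 0" by (simp add: g_def)
qed

text \<open>
  If \<open>m x0 \<noteq> 0\<close>, then extending the logarithm over the bounded component of \<open>x0\<close> by Tietze's theorem
  turns \<open>(w - x0) powi m x0\<close> into a function without zeros on the whole plane that is unchanged
  outside that component. It has a logarithm, hence so has \<open>(w - x0) powi m x0\<close> on a large circle.
\<close>

lemma has_log_on_prod_imp_zero:
  assumes K: "compact K" and P: "finite P" "P \<inter> K = {}"
    and sep: "\<And>x y. x \<in> P \<Longrightarrow> y \<in> P \<Longrightarrow> x \<noteq> y \<Longrightarrow> \<not> connected_component (- K) x y"
    and log: "has_log_on K (\<lambda>w. \<Prod>x\<in>P. (w - x) powi m x)"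
    and x0: "x0 \<in> P" "bounded (connected_component_set (- K) x0)"
  shows "m x0 = 0"
proof -
  define W where "W = connected_component_set (- K) x0"
  have clK: "closed K" using K by (rule compact_imp_closed)
  have openW: "open W" unfolding W_def using clK by (simp add: open_connected_component open_Compl)
  have WK: "W \<inter> K = {}" unfolding W_def using connected_component_subset by fastforce
  have "frontier W \<subseteq> K"
    using frontier_of_connected_component_subset[of "- K" x0] clK frontier_subset_eq[of K]
    unfolding W_def frontier_complement by blast
  \<comment> \<open>Taking the closure of \<open>W\<close> adds only frontier points, and these lie
    in \<open>K\<close>. Hence the two cases in the definition of \<open>q\<close> are glued along
    closed sets.\<close>
  then have "closure W \<union> K = W \<union> K"
    using openW closure_subset[of W] unfolding frontier_def by (auto simp: interior_open)
  then have clWK: "closed (W \<union> K)" using clK by (metis closed_Un closed_closure)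
  have x0W: "x0 \<in> W" unfolding W_def using x0 P by (auto simp: connected_component_refl_eq)
  \<comment> \<open>The points of \<open>P\<close> lie in different components, so the factors other
    than that of \<open>x0\<close> have neither zeros nor poles on
    \<open>W \<union> K\<close>.\<close>
  have notin: "x \<notin> W \<union> K" if "x \<in> P - {x0}" for x
    using that P sep[of x0 x] x0 unfolding W_def by auto
  obtain h where h: "continuous_on K h" "\<And>w. w \<in> K \<Longrightarrow> (\<Prod>x\<in>P. (w - x) powi m x) = exp (h w)"
    using log unfolding has_log_on_def by blast
  obtain h' :: "complex \<Rightarrow> complex" where h': "continuous_on UNIV h'" "\<And>w. w \<in> K \<Longrightarrow> h' w = h w"
    using Tietze_unbounded[of K h UNIV] h(1) clK by auto
  define A where "A w = exp (h' w) / (\<Prod>x\<in>P-{x0}. (w - x) powi m x)" for w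
  define q where "q w = (if w \<in> W \<union> K then A w else (w - x0) powi m x0)" for w
  have nzp: "(\<Prod>x\<in>P-{x0}. (w - x) powi m x) \<noteq> 0" if "w \<in> W \<union> K" for w
    using P(1) notin that by (auto simp: power_int_eq_0_iff)
  have AK: "A w = (w - x0) powi m x0" if "w \<in> K" for w
  proof -
    have "exp (h' w) = (\<Prod>x\<in>P. (w - x) powi m x)" using h h' that by simp
    also have "\<dots> = (w - x0) powi m x0 * (\<Prod>x\<in>P-{x0}. (w - x) powi m x)"
      using P(1) x0(1) by (rule prod.remove)
    finally show ?thesis unfolding A_def using nzp[of w] that by simp
  qed
  have "continuous_on ((W \<union> K) \<union> (- W)) q"
    unfolding q_def
  proof (rule continuous_on_cases)
    show "closed (W \<union> K)" by (fact clWK)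
    show "closed (- W)" using openW by blast
    have "continuous_on (W \<union> K) (\<lambda>w. \<Prod>x\<in>P-{x0}. (w - x) powi m x)"
      using notin by (intro continuous_on_prod continuous_on_power_int continuous_intros) auto
    then show "continuous_on (W \<union> K) A"
      unfolding A_def using nzp h'(1)
      by (intro continuous_on_divide continuous_on_exp) (auto intro: continuous_on_subset)
    show "continuous_on (- W) (\<lambda>w. (w - x0) powi m x0)"
      using x0W by (intro continuous_on_power_int continuous_intros) auto
    show "\<forall>x. x \<in> W \<union> K \<and> x \<notin> W \<union> K \<or> x \<in> - W \<and> x \<in> W \<union> K \<longrightarrow> A x = (x - x0) powi m x0"
      using AK by auto
  qed
  moreover have "(W \<union> K) \<union> (- W) = UNIV" by blast
  ultimately have q: "continuous_on UNIV q" by simp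
  have qnz: "q w \<noteq> 0" for w
    using nzp[of w] x0W unfolding q_def A_def by (auto simp: power_int_eq_0_iff)
  obtain l where l: "continuous_on UNIV l" "\<And>w. q w = exp (l w)"
    using continuous_logarithm_on_contractible[OF q contractible_UNIV] qnz by (metis UNIV_I)
  have "bounded (W \<union> K)" using x0(2) K unfolding W_def by (simp add: compact_imp_bounded)
  then obtain r0 where r0: "W \<union> K \<subseteq> ball x0 r0" by (metis bounded_subset_ballD)
  \<comment> \<open>The maximum with 1 supplies the positive radius needed for the circle.\<close>
  define r where "r = max r0 1"
  have out: "w \<notin> W \<union> K" if "w \<in> sphere x0 r" for w
    using that r0 unfolding r_def by (auto simp: subset_iff)
  have "has_log_on (sphere x0 r) (\<lambda>w. (w - x0) powi m x0)"
    unfolding has_log_on_def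
  proof (intro exI[of _ l] conjI ballI)
    show "continuous_on (sphere x0 r) l" using l(1) by (rule continuous_on_subset) simp
    fix w assume "w \<in> sphere x0 r"
    then have "q w = (w - x0) powi m x0" using out[of w] unfolding q_def by argo
    then show "(w - x0) powi m x0 = exp (l w)" using l(2)[of w] by argo
  qed
  then show ?thesis using not_has_log_on_circle[of r x0 "m x0"] unfolding r_def by simp
qed

lemma exp_eq_imp_int_multiple:
  assumes "exp a = exp (b :: complex)"
  obtains n :: int where "a = b + 2 * of_int n * of_real pi * \<i>"
proof -
  obtain n :: int where "a = b + (of_int (2 * n) * pi) * \<i>"
    using assms unfolding exp_eq by blast
  then show thesis using that[of n] by simp
qed

text \<open>
  On \<open>X\<close> and on \<open>E\<close> separately, \<open>(w - x) / (w - y)\<close> and \<open>(w - x) / (w - z)\<close> have logarithms. Each quotient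
  has an integer obstruction to gluing the two logarithms at \<open>a\<close> and \<open>b\<close>, and some nontrivial
  integer combination of the two obstructions vanishes.
\<close>

lemma glued_arc_splits_at_most_two:
  fixes x y z :: complex
  assumes X: "compact X" and E: "compact E" "connected (- E)" and XE: "X \<inter> E = {a, b}"
    and xy: "connected_component (- X) x y" and xz: "connected_component (- X) x z"
    and notin: "x \<notin> E" "y \<notin> E" "z \<notin> E"
    and sep: "\<not> connected_component (- (X \<union> E)) x y" "\<not> connected_component (- (X \<union> E)) x z"
      "\<not> connected_component (- (X \<union> E)) y z"
  shows False
proof -
  define K where "K = X \<union> E"
  have K: "compact K" unfolding K_def using X E by blast
  have inX: "x \<notin> X" "y \<notin> X" "z \<notin> X"
    using connected_component_in[OF xy] connected_component_in[OF xz] by auto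
  have ne: "x \<noteq> y" "x \<noteq> z" "y \<noteq> z"
    using sep inX notin by (auto simp: connected_component_refl_eq)
  have cE: "connected_component (- E) u v" if "u \<notin> E" "v \<notin> E" for u v
    using E(2) that by (simp add: connected_iff_connected_component)
  obtain h1 where h1: "continuous_on X h1" "\<And>w. w \<in> X \<Longrightarrow> (w - x) / (w - y) = exp (h1 w)"
    using has_log_on_quotient[OF X xy] unfolding has_log_on_def by blast
  obtain h2 where h2: "continuous_on X h2" "\<And>w. w \<in> X \<Longrightarrow> (w - x) / (w - z) = exp (h2 w)"
    using has_log_on_quotient[OF X xz] unfolding has_log_on_def by blast
  obtain k1 where k1: "continuous_on E k1" "\<And>w. w \<in> E \<Longrightarrow> (w - x) / (w - y) = exp (k1 w)"
    using has_log_on_quotient[OF E(1) cE[OF notin(1,2)]] unfolding has_log_on_def by blast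
  obtain k2 where k2: "continuous_on E k2" "\<And>w. w \<in> E \<Longrightarrow> (w - x) / (w - z) = exp (k2 w)"
    using has_log_on_quotient[OF E(1) cE[OF notin(1,3)]] unfolding has_log_on_def by blast
  have ab: "a \<in> X" "a \<in> E" "b \<in> X" "b \<in> E" using XE by auto
  have e: "exp (h1 a) = exp (k1 a)" "exp (h2 a) = exp (k2 a)"
     "exp (h1 b) = exp (k1 b)" "exp (h2 b) = exp (k2 b)"
    using ab h1(2) h2(2) k1(2) k2(2) by metis+
  obtain A1 where A1: "h1 a = k1 a + 2 * of_int A1 * of_real pi * \<i>" using exp_eq_imp_int_multiple[OF e(1)] .
  obtain A2 where A2: "h2 a = k2 a + 2 * of_int A2 * of_real pi * \<i>" using exp_eq_imp_int_multiple[OF e(2)] .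
  obtain B1 where B1: "h1 b = k1 b + 2 * of_int B1 * of_real pi * \<i>" using exp_eq_imp_int_multiple[OF e(3)] .
  obtain B2 where B2: "h2 b = k2 b + 2 * of_int B2 * of_real pi * \<i>" using exp_eq_imp_int_multiple[OF e(4)] .
  \<comment> \<open>\<open>p\<close> and \<open>q\<close> form a nontrivial integer solution of p
    (B1 - A1) + q (B2 - A2) = 0; the first case avoids the zero solution when both differences
    vanish.\<close>
  define p where "p = (if B1 = A1 \<and> B2 = A2 then 1 else B2 - A2)"
  define q where "q = (if B1 = A1 \<and> B2 = A2 then 0 else A1 - B1)"
  have pq: "p \<noteq> 0 \<or> q \<noteq> 0" unfolding p_def q_def by auto
  have "p * (B1 - A1) + q * (B2 - A2) = 0" unfolding p_def q_def by (auto simp: algebra_simps)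
  then have "p * B1 + q * B2 = p * A1 + q * A2" by (simp add: algebra_simps)
  then have eqN: "of_int p * of_int B1 + of_int q * of_int B2 = (of_int p * of_int A1 + of_int q * of_int A2 :: complex)"
    by (metis of_int_add of_int_mult)
  \<comment> \<open>The common jump of the combined logarithms at \<open>a\<close> and
    \<open>b\<close>. It is a multiple of 2 pi i, so adding it changes no exponential.\<close>
  define c where "c = 2 * (of_int p * of_int A1 + of_int q * of_int A2) * of_real pi * \<i>"
  define HX where "HX w = of_int p * h1 w + of_int q * h2 w" for w
  define HE where "HE w = of_int p * k1 w + of_int q * k2 w + c" for w
  define H where "H w = (if w \<in> X then HX w else HE w)" for w
  have HXa: "HX a = HE a" unfolding HX_def HE_def c_def A1 A2 by (simp add: algebra_simps)
  have "HX b = of_int p * k1 b + of_int q * k2 b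
      + 2 * (of_int p * of_int B1 + of_int q * of_int B2) * of_real pi * \<i>"
    unfolding HX_def B1 B2 by (simp add: algebra_simps)
  then have HXb: "HX b = HE b" unfolding HE_def c_def eqN .
  have "exp c = exp 0"
    unfolding exp_eq c_def by (rule exI[of _ "p * A1 + q * A2"]) simp
  then have cexp: "exp c = 1" by simp
  have contH: "continuous_on (X \<union> E) H"
    unfolding H_def
  proof (rule continuous_on_cases)
    show "closed X" "closed E" using X E compact_imp_closed by auto
    show "continuous_on X HX" unfolding HX_def using h1 h2 by (intro continuous_intros) auto
    show "continuous_on E HE" unfolding HE_def using k1 k2 by (intro continuous_intros) auto
    show "\<forall>x. x \<in> X \<and> x \<notin> X \<or> x \<in> E \<and> x \<in> X \<longrightarrow> HX x = HE x"
      using XE HXa HXb by auto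
  qed
  define R where "R w = ((w - x) / (w - y)) powi p * ((w - x) / (w - z)) powi q" for w
  have RX: "R w = exp (HX w)" if "w \<in> X" for w
    unfolding R_def HX_def using h1(2)[OF that] h2(2)[OF that] by (simp add: exp_add exp_power_int)
  have RE: "R w = exp (HE w)" if "w \<in> E" for w
    unfolding R_def HE_def using k1(2)[OF that] k2(2)[OF that] cexp by (simp add: exp_add exp_power_int)
  have logR: "has_log_on K R"
    unfolding has_log_on_def K_def
    by (rule exI[of _ H]) (use contH RX RE in \<open>auto simp: H_def\<close>)
  define P where "P = {x, y, z}"
  define m where "m v = (if v = x then p + q else if v = y then - p else - q)" for v
  have prod: "(\<Prod>v\<in>P. (w - v) powi m v) = R w" if "w \<in> K" for w
  proof -
    have nz: "w - x \<noteq> 0" "w - y \<noteq> 0" "w - z \<noteq> 0" using that inX notin unfolding K_def by auto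
    show ?thesis using ne nz unfolding P_def m_def R_def
      by (simp add: power_int_divide_distrib power_int_add power_int_minus divide_simps)
  qed
  have m0: "m v = 0" if "v \<in> P" "bounded (connected_component_set (- K) v)" for v
  proof (rule has_log_on_prod_imp_zero[OF K, of P m v])
    show "finite P" unfolding P_def by simp
    show "P \<inter> K = {}" using inX notin unfolding P_def K_def by auto
    show "\<not> connected_component (- K) u v" if "u \<in> P" "v \<in> P" "u \<noteq> v" for u v
      using that sep sep[THEN contrapos_nn, OF connected_component_sym] unfolding P_def K_def by auto
    show "has_log_on K (\<lambda>w. \<Prod>x\<in>P. (w - x) powi m x)"
      by (rule has_log_on_cong[OF logR]) (rule prod)
    show "v \<in> P" "bounded (connected_component_set (- K) v)" by (fact that)+
  qed
  \<comment> \<open>The complement of a compact set in the plane has only one unbounded component.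
    So at least two of the three points lie in bounded components and have exponent 0, and any two
    of the exponents p + q, -p, -q vanish only if \<open>p\<close> and \<open>q\<close> do.\<close>
  have unb: "bounded (connected_component_set (- K) u) \<or> bounded (connected_component_set (- K) v)"
    if uv: "u \<in> P" "v \<in> P" "\<not> connected_component (- K) u v" for u v
  proof (rule ccontr)
    assume *: "\<not> ?thesis"
    have eq: "connected_component_set (- K) u = connected_component_set (- K) v"
      using * K by (intro cobounded_unique_unbounded_component) (auto simp: compact_imp_bounded)
    have "v \<notin> K" using uv(2) inX notin unfolding P_def K_def by blast
    then have "v \<in> connected_component_set (- K) v" by (simp add: connected_component_refl_eq)
    then have "v \<in> connected_component_set (- K) u" unfolding eq .
    then show False using uv(3) by simp
  qed
  have xP: "x \<in> P" "y \<in> P" "z \<in> P" unfolding P_def by auto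
  have mm: "m x = p + q" "m y = - p" "m z = - q" using ne unfolding m_def by auto
  have "m x = 0 \<or> m y = 0" "m x = 0 \<or> m z = 0" "m y = 0 \<or> m z = 0"
    using unb[of x y] unb[of x z] unb[of y z] m0 xP sep unfolding K_def by blast+
  then show False using pq unfolding mm by auto
qed

section \<open>Gluing an arc to a compact set\<close>

text \<open>A path in \<open>X\<close> between the ends of \<open>e\<close> contains an arc that
  completes \<open>e\<close> to a Jordan curve. The midpoint of \<open>e\<close> has a neighbourhood
  free of \<open>X\<close>, and this neighbourhood meets both sides of the curve.\<close>

lemma arc_of_loop_separates:
  fixes e :: "real \<Rightarrow> complex"
  assumes X: "compact X" and e: "arc e" and XE: "X \<inter> path_image e = {pathstart e, pathfinish e}"
    and pc: "path_component X (pathstart e) (pathfinish e)"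
  obtains x y where "x \<notin> X \<union> path_image e" "y \<notin> X \<union> path_image e" "connected_component (- X) x y"
    "\<not> connected_component (- (X \<union> path_image e)) x y"
proof -
  have ne: "pathfinish e \<noteq> pathstart e" using arc_distinct_ends[OF e] by auto
  obtain g where g: "path g" "path_image g \<subseteq> X" "pathstart g = pathstart e" "pathfinish g = pathfinish e"
    using pc unfolding path_component_def by blast
  obtain c where c: "arc c" "path_image c \<subseteq> path_image g" "pathstart c = pathfinish e" "pathfinish c = pathstart e"
    using path_contains_arc[of "reversepath g" "pathfinish e" "pathstart e"] g ne by auto
  have "path_image e \<inter> path_image c \<subseteq> {pathstart e, pathstart c}"
    using XE c(2,3) g(2) by auto
  then have sp: "simple_path (e +++ c)"
    using simple_path_join_loop[OF e c(1)] c by simp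
  define J where "J = path_image (e +++ c)"
  have J: "J = path_image e \<union> path_image c"
    unfolding J_def using c by (simp add: path_image_join)
  have jord: "frontier (inside J) = J" "frontier (outside J) = J" "inside J \<inter> outside J = {}"
    "inside J \<union> outside J = - J"
    using Jordan_inside_outside[OF sp] c unfolding J_def by auto
  define p where "p = e (1/2)"
  have pE: "p \<in> path_image e" unfolding p_def path_image_def by auto
  have "p \<noteq> pathstart e" "p \<noteq> pathfinish e"
    using e unfolding p_def arc_def pathstart_def pathfinish_def inj_on_def by force+
  then have "p \<notin> X" using XE pE by auto
  then obtain r where r: "0 < r" "ball p r \<subseteq> - X"
    using X compact_imp_closed[OF X] by (metis ComplI open_Compl openE)
  have "p \<in> J" using pE J by auto
  then have "p \<in> closure (inside J)" "p \<in> closure (outside J)"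
    using jord unfolding frontier_def by auto
  then obtain x y where xy: "x \<in> inside J" "x \<in> ball p r" "y \<in> outside J" "y \<in> ball p r"
    using r(1) unfolding closure_approachable by (metis dist_commute mem_ball)
  have "x \<notin> J" "y \<notin> J" using xy(1,3) jord(4) by blast+
  show ?thesis
  proof
    show "x \<notin> X \<union> path_image e" "y \<notin> X \<union> path_image e"
      using \<open>x \<notin> J\<close> \<open>y \<notin> J\<close> xy r J by auto
    show "connected_component (- X) x y"
      using xy r by (intro connected_componentI[of "ball p r"]) auto
    show "\<not> connected_component (- (X \<union> path_image e)) x y"
    proof
      assume "connected_component (- (X \<union> path_image e)) x y"
      then have "connected_component (- J) x y"
        using c(2) g(2) unfolding J by (elim connected_component_of_subset) blast
      then have "y \<in> inside J"
        using xy(1) inside_same_component by blast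
      then show False using xy(3) jord(3) by blast
    qed
  qed
qed

text \<open>An arc is homeomorphic to an interval, so a nonempty open subset of the plane inside it
  would embed in the line, against invariance of dimension.\<close>

lemma interior_arc_empty:
  fixes e :: "real \<Rightarrow> complex"
  assumes "arc e"
  shows "interior (path_image e) = {}"
proof (rule ccontr)
  assume ne: "interior (path_image e) \<noteq> {}"
  obtain g where g: "homeomorphism {0..1} (path_image e) e g"
    using homeomorphism_arc[OF assms] by blast
  have "inj_on g (path_image e)"
    using g unfolding homeomorphism_def by (metis inj_on_inverseI)
  moreover have "continuous_on (path_image e) g" using g unfolding homeomorphism_def by blast
  ultimately have "inj_on g (interior (path_image e))" "continuous_on (interior (path_image e)) g"
    using interior_subset by (blast intro: inj_on_subset continuous_on_subset)+
  then have "DIM(complex) \<le> DIM(real)"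
    using ne by (intro invariance_of_dimension[of "interior (path_image e)" g]) auto
  then show False by simp
qed

lemma finite_if_no_three:
  assumes "\<And>x y z. x \<in> S \<Longrightarrow> y \<in> S \<Longrightarrow> z \<in> S \<Longrightarrow> x \<noteq> y \<Longrightarrow> x \<noteq> z \<Longrightarrow> y \<noteq> z \<Longrightarrow> False"
  shows "finite S" "card S \<le> 2"
proof -
  have *: False if T: "T \<subseteq> S" "card T = 3" for T
  proof -
    obtain x y z where "T = {x, y, z}" "x \<noteq> y" "x \<noteq> z" "y \<noteq> z"
      using T(2) unfolding card_3_iff by blast
    then show False using assms[of x y z] T(1) by auto
  qed
  show "finite S"
  proof (rule ccontr)
    assume "infinite S"
    then obtain T where "T \<subseteq> S" "card T = 3" by (meson infinite_arbitrarily_large)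
    then show False by (rule *)
  qed
  show "card S \<le> 2"
  proof (rule ccontr)
    assume "\<not> card S \<le> 2"
    then have "3 \<le> card S" by simp
    then obtain T where "T \<subseteq> S" "card T = 3" by (rule obtain_subset_with_card_n)
    then show False by (rule *)
  qed
qed

lemma components_not_connected_component:
  assumes "C \<in> components S" "D \<in> components S" "C \<noteq> D" "x \<in> C" "y \<in> D"
  shows "\<not> connected_component S x y"
proof
  assume xy: "connected_component S x y"
  have "C = connected_component_set S x" "D = connected_component_set S y"
    using assms by (metis componentsE connected_component_eq)+
  then show False using xy assms(3) by (simp add: connected_component_eq)
qed

text \<open>An arc does not separate the plane, so \<open>glued_arc_splits_at_most_two\<close>
  applies to points chosen from the three components.\<close>

lemma glued_arc_three_components:
  fixes e :: "real \<Rightarrow> complex"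
  assumes X: "compact X" and e: "arc e" and XE: "X \<inter> path_image e = {pathstart e, pathfinish e}"
    and F: "F1 \<in> components (- (X \<union> path_image e))" "F2 \<in> components (- (X \<union> path_image e))"
      "F3 \<in> components (- (X \<union> path_image e))" "F1 \<noteq> F2" "F1 \<noteq> F3" "F2 \<noteq> F3"
    and x: "x1 \<in> F1" "x2 \<in> F2" "x3 \<in> F3"
    and c: "connected_component (- X) x1 x2" "connected_component (- X) x1 x3"
  shows False
proof (rule glued_arc_splits_at_most_two[OF X _ _ XE c])
  show "compact (path_image e)" "connected (- path_image e)"
    using e by (auto simp: compact_arc_image connected_arc_complement)
  show "x1 \<notin> path_image e" "x2 \<notin> path_image e" "x3 \<notin> path_image e"
    using F(1-3)[THEN in_components_subset] x by auto
  show "\<not> connected_component (- (X \<union> path_image e)) x1 x2"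
    "\<not> connected_component (- (X \<union> path_image e)) x1 x3"
    "\<not> connected_component (- (X \<union> path_image e)) x2 x3"
    using components_not_connected_component F x by blast+
qed

text \<open>A component of the complement of \<open>X\<close> contains a new component, since an arc
  has empty interior; choosing one gives the injection \<open>f\<close>. It contains at most two new
  components, whence finiteness. If the ends of the arc are joined in \<open>X\<close>, some
  component splits and \<open>f\<close> misses one of its pieces.\<close>

lemma components_glued_arc:
  fixes e :: "real \<Rightarrow> complex"
  assumes X: "compact X" and e: "arc e" and XE: "X \<inter> path_image e = {pathstart e, pathfinish e}"
    and fin: "finite (components (- X))"
  shows "finite (components (- (X \<union> path_image e)))" (is "finite ?K")
    and "card (components (- X)) \<le> card (components (- (X \<union> path_image e)))"
    and "path_component X (pathstart e) (pathfinish e) \<Longrightarrow> card (components (- X)) < card (components (- (X \<union> path_image e)))"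
proof -
  define E where "E = path_image e"
  note XE = XE[folded E_def]
  have cmp: "connected_component (- X) x y" if "x \<in> C" "y \<in> C" "C \<in> components (- X)" for x y C
    using that(1,2) in_components_connected[OF that(3)] in_components_subset[OF that(3)]
    by (intro connected_componentI[of C])
  have sub: "\<exists>C\<in>components (- X). D \<subseteq> C" if "D \<in> components (- (X \<union> E))" for D
    using that in_components_subset[OF that] exists_component_superset[of D "- X"]
      in_components_nonempty[OF that] in_components_connected[OF that]
    by blast
  have "finite {D \<in> components (- (X \<union> E)). D \<subseteq> C}" if C: "C \<in> components (- X)" for C
  proof (rule finite_if_no_three(1))
    fix F1 F2 F3
    assume *: "F1 \<in> {D \<in> components (- (X \<union> E)). D \<subseteq> C}" "F2 \<in> {D \<in> components (- (X \<union> E)). D \<subseteq> C}"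
      "F3 \<in> {D \<in> components (- (X \<union> E)). D \<subseteq> C}" "F1 \<noteq> F2" "F1 \<noteq> F3" "F2 \<noteq> F3"
    then obtain x1 x2 x3 where "x1 \<in> F1" "x2 \<in> F2" "x3 \<in> F3"
      using in_components_nonempty by blast
    then show False
      using glued_arc_three_components[OF X e XE[unfolded E_def], of F1 F2 F3 x1 x2 x3] * cmp[OF _ _ C]
      unfolding E_def by blast
  qed
  then have "finite (\<Union>C\<in>components (- X). {D \<in> components (- (X \<union> E)). D \<subseteq> C})"
    using fin by blast
  moreover have "components (- (X \<union> E)) \<subseteq> (\<Union>C\<in>components (- X). {D \<in> components (- (X \<union> E)). D \<subseteq> C})"
    using sub by blast
  ultimately have finK: "finite (components (- (X \<union> E)))" by (rule finite_subset[rotated])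
  then show "finite ?K" unfolding E_def .
  have "\<exists>D. D \<in> components (- (X \<union> E)) \<and> D \<subseteq> C" if C: "C \<in> components (- X)" for C
  proof -
    have "open C" using C X by (meson compact_imp_closed open_Compl open_components)
    then have "\<not> C \<subseteq> E"
      using interior_arc_empty[OF e] in_components_nonempty[OF C] interior_maximal unfolding E_def by blast
    then obtain x where x: "x \<in> C" "x \<notin> E" by blast
    then have xn: "x \<in> - (X \<union> E)" using in_components_subset[OF C] by auto
    let ?D = "connected_component_set (- (X \<union> E)) x"
    have "?D \<in> components (- (X \<union> E))" using xn by (rule componentsI)
    moreover have "?D \<subseteq> C"
    proof (rule components_maximal[OF C])
      show "connected ?D" by simp
      show "?D \<subseteq> - X" using connected_component_subset[of "- (X \<union> E)" x] by auto
      show "C \<inter> ?D \<noteq> {}" using x xn by (auto simp: connected_component_refl_eq)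
    qed
    ultimately show ?thesis by blast
  qed
  then obtain f where f: "\<And>C. C \<in> components (- X) \<Longrightarrow> f C \<in> components (- (X \<union> E)) \<and> f C \<subseteq> C"
    by metis
  have "inj_on f (components (- X))"
  proof (rule inj_onI)
    fix C D assume CD: "C \<in> components (- X)" "D \<in> components (- X)" "f C = f D"
    then have "f C \<subseteq> C \<inter> D" "f C \<noteq> {}" using f in_components_nonempty by blast+
    then show "C = D" using components_nonoverlap[OF CD(1,2)] by blast
  qed
  then have cf: "card (f ` components (- X)) = card (components (- X))" by (rule card_image)
  have fs: "f ` components (- X) \<subseteq> components (- (X \<union> E))" using f by blast
  show "card (components (- X)) \<le> card ?K"
    using card_mono[OF finK fs] cf unfolding E_def by simp
  assume "path_component X (pathstart e) (pathfinish e)"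
  from arc_of_loop_separates[OF X e XE[unfolded E_def] this] obtain x y where
    xy: "x \<notin> X \<union> E" "y \<notin> X \<union> E" "connected_component (- X) x y" "\<not> connected_component (- (X \<union> E)) x y"
    unfolding E_def by metis
  let ?D = "connected_component_set (- (X \<union> E))"
  have xn: "x \<in> ?D x" "y \<in> ?D y" using xy(1,2) by (auto simp: connected_component_refl_eq)
  have D: "?D x \<in> components (- (X \<union> E))" "?D y \<in> components (- (X \<union> E))"
    using xy(1,2) by (auto intro: componentsI)
  have ne: "?D x \<noteq> ?D y"
  proof
    assume "?D x = ?D y"
    with xn(2) have "y \<in> ?D x" by simp
    then show False using xy(4) by simp
  qed
  have "?D x \<notin> f ` components (- X) \<or> ?D y \<notin> f ` components (- X)"
  proof (rule ccontr)
    assume "\<not> ?thesis"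
    then obtain C C' where C: "C \<in> components (- X)" "C' \<in> components (- X)" "?D x = f C" "?D y = f C'"
      by blast
    then have "x \<in> C" "y \<in> C'" using xn f by blast+
    then have "C = C'" using components_not_connected_component[OF C(1,2)] xy(3) by blast
    then show False using C ne by simp
  qed
  then have "f ` components (- X) \<subset> components (- (X \<union> E))" using fs D by blast
  from psubset_card_mono[OF finK this] show "card (components (- X)) < card ?K"
    using cf unfolding E_def by simp
qed

text \<open>The arc without its ends is connected and avoids \<open>X\<close>, so it lies in one
  component of the complement of \<open>X\<close>. Every face with an inner point of the arc on its
  frontier reaches into that component, which cannot contain points of three such faces.\<close>

lemma faces_at_arc:
  fixes e :: "real \<Rightarrow> complex"
  assumes X: "compact X" and e: "arc e" and XE: "X \<inter> path_image e = {pathstart e, pathfinish e}"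
  shows "finite {F \<in> components (- (X \<union> path_image e)).
            frontier F \<inter> (path_image e - {pathstart e, pathfinish e}) \<noteq> {}}" (is "finite ?S")
    and "card {F \<in> components (- (X \<union> path_image e)).
            frontier F \<inter> (path_image e - {pathstart e, pathfinish e}) \<noteq> {}} \<le> 2"
proof -
  define E where "E = path_image e - {pathstart e, pathfinish e}"
  have E: "connected E" "E \<subseteq> - X"
    using connected_simple_path_endless[OF arc_imp_simple_path[OF e]] XE unfolding E_def by auto
  have pt: "\<exists>p\<in>E. \<exists>x\<in>F. connected_component (- X) p x" if "F \<in> ?S" for F
  proof -
    have "frontier F \<inter> E \<noteq> {}" using that unfolding E_def by simp
    then obtain p where p: "p \<in> frontier F" "p \<in> E" by blast
    then obtain r where r: "0 < r" "ball p r \<subseteq> - X"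
      using E(2) compact_imp_closed[OF X] by (metis open_Compl openE subsetD)
    have "p \<in> closure F" using p unfolding frontier_def by simp
    then obtain x where "x \<in> F" "dist x p < r" using r(1) unfolding closure_approachable by blast
    then show ?thesis using p r by (intro bexI[of _ p] bexI[of _ x] connected_componentI[of "ball p r"])
        (auto simp: dist_commute)
  qed
  have three: False if F: "F1 \<in> ?S" "F2 \<in> ?S" "F3 \<in> ?S" "F1 \<noteq> F2" "F1 \<noteq> F3" "F2 \<noteq> F3" for F1 F2 F3
  proof -
    obtain p1 x1 where 1: "p1 \<in> E" "x1 \<in> F1" "connected_component (- X) p1 x1" using pt[OF F(1)] by blast
    obtain p2 x2 where 2: "p2 \<in> E" "x2 \<in> F2" "connected_component (- X) p2 x2" using pt[OF F(2)] by blast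
    obtain p3 x3 where 3: "p3 \<in> E" "x3 \<in> F3" "connected_component (- X) p3 x3" using pt[OF F(3)] by blast
    have "connected_component (- X) p1 p2" "connected_component (- X) p1 p3"
      using E 1 2 3 by (auto intro: connected_componentI)
    then have "connected_component (- X) x1 x2" "connected_component (- X) x1 x3"
      using 1 2 3 by (meson connected_component_sym connected_component_trans)+
    then show False
      using glued_arc_three_components[OF X e XE] F 1(2) 2(2) 3(2) by blast
  qed
  show "finite ?S" by (rule finite_if_no_three(1)) (rule three)
  show "card ?S \<le> 2" by (rule finite_if_no_three(2)) (rule three)
qed

section \<open>Edge bounds for plane graphs\<close>

text \<open>Edge sets are meant to hold one direction of each edge; the symmetric closure makes
  reachability undirected.\<close>

definition linked :: "('a \<times> 'a) set \<Rightarrow> ('a \<times> 'a) set" where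
  "linked B = (B \<union> B\<inverse>)\<^sup>*"

lemma linked_refl [simp]: "(u, u) \<in> linked B"
  unfolding linked_def by simp

lemma linked_arc: "(u, v) \<in> B \<Longrightarrow> (u, v) \<in> linked B"
  unfolding linked_def by auto

lemma linked_sym: "(u, v) \<in> linked B \<Longrightarrow> (v, u) \<in> linked B"
  unfolding linked_def using sym_rtrancl[OF sym_Un_converse] by (rule symD)

lemma linked_trans: "(u, v) \<in> linked B \<Longrightarrow> (v, w) \<in> linked B \<Longrightarrow> (u, w) \<in> linked B"
  unfolding linked_def by (rule rtrancl_trans)

lemma linked_mono: "B \<subseteq> B' \<Longrightarrow> linked B \<subseteq> linked B'"
  unfolding linked_def by (intro rtrancl_mono) auto

definition classes :: "'a set \<Rightarrow> ('a \<times> 'a) set \<Rightarrow> 'a set set" where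
  "classes V B = (\<lambda>v. linked B `` {v}) ` V"

lemma linked_class_eq: "(u, v) \<in> linked B \<Longrightarrow> linked B `` {u} = linked B `` {v}"
  using linked_sym linked_trans by fast

text \<open>\<open>\<phi>\<close> sends each old class to the new class containing it and is onto.
  If \<open>u\<close> and \<open>v\<close> were not linked, it identifies their two classes.\<close>

lemma classes_insert:
  assumes V: "finite V" and uv: "u \<in> V" "v \<in> V"
  shows "card (classes V (insert (u, v) B)) \<le> card (classes V B)"
    and "(u, v) \<notin> linked B \<Longrightarrow> card (classes V (insert (u, v) B)) < card (classes V B)"
proof -
  let ?B = "insert (u, v) B"
  define \<phi> where "\<phi> C = linked ?B `` C" for C
  have fin: "finite (classes V B)" using V unfolding classes_def by simp
  have \<phi>: "\<phi> (linked B `` {w}) = linked ?B `` {w}" for w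
    unfolding \<phi>_def using linked_mono[of B ?B] linked_trans[of _ _ ?B] by (auto intro: linked_refl)
  then have im: "classes V ?B = \<phi> ` classes V B"
    unfolding classes_def image_image by simp
  then show "card (classes V ?B) \<le> card (classes V B)"
    using card_image_le[OF fin] by simp
  assume nl: "(u, v) \<notin> linked B"
  let ?Cu = "linked B `` {u}" and ?Cv = "linked B `` {v}"
  have "\<phi> ?Cu = \<phi> ?Cv" unfolding \<phi> by (rule linked_class_eq[OF linked_arc[OF insertI1]])
  moreover have "?Cu \<noteq> ?Cv"
  proof
    assume eq: "?Cu = ?Cv"
    have "v \<in> ?Cv" by simp
    then have "v \<in> ?Cu" unfolding eq .
    then show False using nl by simp
  qed
  moreover have Cin: "?Cu \<in> classes V B" "?Cv \<in> classes V B" using uv unfolding classes_def by auto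
  ultimately have "\<phi> ?Cv \<in> \<phi> ` (classes V B - {?Cv})" by (intro image_eqI[of _ _ ?Cu]) auto
  then have "\<phi> ` classes V B \<subseteq> \<phi> ` (classes V B - {?Cv})" by blast
  then have "card (classes V ?B) \<le> card (classes V B - {?Cv})"
    unfolding im using surj_card_le[of "classes V B - {?Cv}"] fin by blast
  also have "\<dots> < card (classes V B)"
    using fin Cin(2) by (rule card_Diff1_less)
  finally show "card (classes V ?B) < card (classes V B)" .
qed

text \<open>Acyclicity in the form that every edge is a bridge. A loop, or a pair together with its
  reverse, counts as a cycle here.\<close>

definition forest :: "('a \<times> 'a) set \<Rightarrow> bool" where
  "forest B \<longleftrightarrow> (\<forall>(u, v)\<in>B. (u, v) \<notin> linked (B - {(u, v)}))"

lemma forest_subset: "forest B \<Longrightarrow> B' \<subseteq> B \<Longrightarrow> forest B'"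
  unfolding forest_def using linked_mono[OF Diff_mono[OF _ order_refl]] by blast

text \<open>Without edges there are at most \<open>card V\<close> classes, and each edge of a
  forest, when inserted, merges two of them.\<close>

lemma card_forest:
  assumes "finite V" "B \<subseteq> V \<times> V" "forest B"
  shows "card B + card (classes V B) \<le> card V"
proof -
  have "finite B" using assms(1,2) finite_subset by blast
  then show ?thesis using assms(2,3)
  proof (induction B)
    case empty
    then show ?case using card_image_le[OF assms(1)] unfolding classes_def by simp
  next
    case (insert e B)
    obtain u v where e: "e = (u, v)" by force
    have "(u, v) \<notin> linked B"
      using insert.prems(2) insert.hyps(2) unfolding forest_def e by auto
    then have "card (classes V (insert e B)) < card (classes V B)"
      using insert.prems(1) assms(1) unfolding e by (intro classes_insert) auto
    moreover have "card B + card (classes V B) \<le> card V"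
      using insert.IH insert.prems forest_subset by blast
    ultimately show ?case using insert.hyps by simp
  qed
qed

section \<open>Plane drawings and Euler's inequality\<close>

text \<open>\<open>A\<close> is to hold one direction of each edge. Unlike in
  \<open>plane_drawing\<close>, edges are compared as pairs, so a reversed pair would count as a
  second edge.\<close>

locale plane_arcs =
  fixes V :: "'a set" and pos :: "'a \<Rightarrow> complex" and \<gamma> :: "'a \<times> 'a \<Rightarrow> real \<Rightarrow> complex"
    and A :: "('a \<times> 'a) set"
  assumes finite_V: "finite V" and A_subset: "A \<subseteq> V \<times> V" and inj_pos: "inj_on pos V"
    and arc_edge: "(u, v) \<in> A \<Longrightarrow> arc (\<gamma> (u, v))"
    and start_edge: "(u, v) \<in> A \<Longrightarrow> pathstart (\<gamma> (u, v)) = pos u"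
    and finish_edge: "(u, v) \<in> A \<Longrightarrow> pathfinish (\<gamma> (u, v)) = pos v"
    and vertex_edge: "(u, v) \<in> A \<Longrightarrow> w \<in> V \<Longrightarrow> pos w \<in> path_image (\<gamma> (u, v)) \<Longrightarrow> w = u \<or> w = v"
    and edge_edge: "(u, v) \<in> A \<Longrightarrow> (x, y) \<in> A \<Longrightarrow> (u, v) \<noteq> (x, y) \<Longrightarrow>
      path_image (\<gamma> (u, v)) \<inter> path_image (\<gamma> (x, y)) \<subseteq> pos ` ({u, v} \<inter> {x, y})"
begin

definition drawing :: "'a set \<Rightarrow> ('a \<times> 'a) set \<Rightarrow> complex set" where
  "drawing W B = pos ` W \<union> (\<Union>e\<in>B. path_image (\<gamma> e))"

lemma finite_A: "finite A"
  using finite_V A_subset by (meson finite_SigmaI finite_subset)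

lemma compact_drawing:
  assumes "W \<subseteq> V" "B \<subseteq> A"
  shows "compact (drawing W B)"
proof -
  have "compact (path_image (\<gamma> e))" if "e \<in> B" for e
    using that assms(2) arc_edge by (cases e) (auto intro: compact_arc_image)
  moreover have "finite W" "finite B" using assms finite_V finite_A finite_subset by auto
  ultimately show ?thesis
    unfolding drawing_def by (intro compact_Un compact_UN) (auto intro: finite_imp_compact)
qed

lemma ends_in_edge: "(u, v) \<in> A \<Longrightarrow> pos u \<in> path_image (\<gamma> (u, v))" "(u, v) \<in> A \<Longrightarrow> pos v \<in> path_image (\<gamma> (u, v))"
  using pathstart_in_path_image pathfinish_in_path_image start_edge finish_edge by metis+

lemma drawing_Int_edge:
  assumes W: "W \<subseteq> V" "B \<subseteq> A" "B \<subseteq> W \<times> W" and e: "(u, v) \<in> A - B"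
  shows "drawing W B \<inter> path_image (\<gamma> (u, v)) = pos ` ({u, v} \<inter> W)"
proof
  show "drawing W B \<inter> path_image (\<gamma> (u, v)) \<subseteq> pos ` ({u, v} \<inter> W)"
  proof
    fix p assume p: "p \<in> drawing W B \<inter> path_image (\<gamma> (u, v))"
    then consider w where "w \<in> W" "p = pos w" | x y where "(x, y) \<in> B" "p \<in> path_image (\<gamma> (x, y))"
      unfolding drawing_def by auto
    then show "p \<in> pos ` ({u, v} \<inter> W)"
    proof cases
      case 1
      then show ?thesis using vertex_edge[of u v w] p e W by auto
    next
      case 2
      then have "p \<in> pos ` ({u, v} \<inter> {x, y})"
        using edge_edge[of u v x y] e p W(2) by auto
      then show ?thesis using 2 W(3) by auto
    qed
  qed
  show "pos ` ({u, v} \<inter> W) \<subseteq> drawing W B \<inter> path_image (\<gamma> (u, v))"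
    using ends_in_edge e unfolding drawing_def by auto
qed

lemma drawing_insert: "drawing W (insert e B) = drawing W B \<union> path_image (\<gamma> e)"
  unfolding drawing_def by auto

lemma drawing_V_Int_edge:
  assumes "B \<subseteq> A" "(u, v) \<in> A - B"
  shows "drawing V B \<inter> path_image (\<gamma> (u, v)) = {pathstart (\<gamma> (u, v)), pathfinish (\<gamma> (u, v))}"
proof -
  have "{u, v} \<inter> V = {u, v}" using assms A_subset by auto
  then show ?thesis
    using drawing_Int_edge[of V B u v] assms A_subset by (auto simp: start_edge finish_edge)
qed

lemma connected_Compl_edge: "(u, v) \<in> A \<Longrightarrow> connected (- path_image (\<gamma> (u, v)))"
  using arc_edge by (auto intro!: connected_arc_complement)

text \<open>Removing an edge, which is a bridge, leaves two disjoint parts. Gluing the edge to the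
  first part, and then the second part to the result, each time involves an intersection in a single
  point, so Janiszewski's theorem keeps the complement connected.\<close>

lemma connected_Compl_forest:
  assumes "W \<subseteq> V" "B \<subseteq> A" "B \<subseteq> W \<times> W" "forest B"
  shows "connected (- drawing W B)"
  using assms
proof (induction "card B" arbitrary: B W rule: less_induct)
  case less
  have finB: "finite B" using less.prems finite_A finite_subset by blast
  show ?case
  proof (cases "B = {}")
    case True
    have cn: "countable (pos ` W)" using less.prems(1) finite_V
      by (meson countable_finite finite_imageI finite_subset)
    then show ?thesis unfolding drawing_def True
      using connected_open_diff_countable[of UNIV "pos ` W"] cn by (simp add: Compl_eq_Diff_UNIV connected_UNIV)
  next
    case False
    then obtain u v where uv: "(u, v) \<in> B" by auto
    define B0 where "B0 = B - {(u, v)}"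
    have nl: "(u, v) \<notin> linked B0" using less.prems(4) uv unfolding forest_def B0_def by blast
    \<comment> \<open>The side of \<open>u\<close> once the edge is removed: no edge of
      \<open>B0\<close> leaves it, and \<open>v\<close> lies outside.\<close>
    define C where "C = linked B0 `` {u}"
    define W1 where "W1 = W \<inter> C"
    define W2 where "W2 = W - C"
    define B1 where "B1 = B0 \<inter> W1 \<times> W1"
    define B2 where "B2 = B0 \<inter> W2 \<times> W2"
    have C_iff: "x \<in> C \<longleftrightarrow> y \<in> C" if "(x, y) \<in> B0" for x y
      using linked_arc[OF that] linked_sym linked_trans unfolding C_def by fast
    have B0: "B0 = B1 \<union> B2"
      using C_iff less.prems(3) unfolding B1_def B2_def W1_def W2_def B0_def by auto
    have uW: "u \<in> W1" "v \<in> W2" "u \<notin> W2" "v \<notin> W1"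
      using uv less.prems(3) nl unfolding W1_def W2_def C_def by auto
    have disj: "W1 \<inter> W2 = {}" unfolding W1_def W2_def by auto
    have uvA: "(u, v) \<in> A - B1" "(u, v) \<in> A - B2" using uv less.prems(2) unfolding B1_def B2_def B0_def by auto
    have W: "W1 \<subseteq> V" "W2 \<subseteq> V" "B1 \<subseteq> A" "B2 \<subseteq> A" "B1 \<subseteq> W1 \<times> W1" "B2 \<subseteq> W2 \<times> W2"
      using less.prems unfolding W1_def W2_def B1_def B2_def B0_def by auto
    have sub: "B1 \<subset> B" "B2 \<subset> B" using uv unfolding B1_def B2_def B0_def by auto
    have c1: "connected (- drawing W1 B1)"
      by (rule less.hyps[OF psubset_card_mono[OF finB sub(1)]])
         (use W forest_subset[OF less.prems(4) psubset_imp_subset[OF sub(1)]] in auto)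
    have c2: "connected (- drawing W2 B2)"
      by (rule less.hyps[OF psubset_card_mono[OF finB sub(2)]])
         (use W forest_subset[OF less.prems(4) psubset_imp_subset[OF sub(2)]] in auto)
    let ?E = "path_image (\<gamma> (u, v))"
    have D1E: "drawing W1 B1 \<inter> ?E = {pos u}"
      using drawing_Int_edge[OF W(1,3,5) uvA(1)] uW by (simp add: Int_insert_left)
    have D2E: "?E \<inter> drawing W2 B2 = {pos v}"
      using drawing_Int_edge[OF W(2,4,6) uvA(2)] uW by (simp add: Int_insert_left Int_commute)
    have D12: "drawing W1 B1 \<inter> drawing W2 B2 = {}"
    proof -
      have pW: "pos ` W1 \<inter> pos ` W2 = {}"
        using inj_on_image_Int[OF inj_pos W(1,2)] disj by simp
      have miss: "path_image (\<gamma> (x, y)) \<inter> pos ` U' = {}"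
        if xy: "(x, y) \<in> A" "x \<in> U" "y \<in> U" and U: "U' \<subseteq> V" "U \<inter> U' = {}" for x y U U'
      proof (rule ccontr)
        assume "\<not> ?thesis"
        then obtain w where "w \<in> U'" "pos w \<in> path_image (\<gamma> (x, y))" by blast
        then show False using vertex_edge[OF xy(1), of w] xy(2,3) U by blast
      qed
      have v1: "path_image (\<gamma> e) \<inter> pos ` W2 = {}" if "e \<in> B1" for e
        using miss[of "fst e" "snd e" W1 W2] subsetD[OF W(3) that] subsetD[OF W(5) that] W(2) disj
        by (simp add: mem_Times_iff)
      have v2: "path_image (\<gamma> e) \<inter> pos ` W1 = {}" if "e \<in> B2" for e
        using miss[of "fst e" "snd e" W2 W1] subsetD[OF W(4) that] subsetD[OF W(6) that] W(1) disj
        by (simp add: mem_Times_iff Int_commute)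
      have ee: "path_image (\<gamma> (x, y)) \<inter> path_image (\<gamma> (x', y')) = {}"
        if "(x, y) \<in> B1" "(x', y') \<in> B2" for x y x' y'
      proof -
        have "{x, y} \<inter> {x', y'} = {}" using that W disj by auto
        moreover then have "(x, y) \<noteq> (x', y')" by auto
        ultimately show ?thesis using edge_edge[of x y x' y'] that W by auto
      qed
      have e12: "path_image (\<gamma> e) \<inter> path_image (\<gamma> e') = {}" if "e \<in> B1" "e' \<in> B2" for e e'
        using that ee by (cases e, cases e') simp
      define U where "U B = (\<Union>e\<in>B. path_image (\<gamma> e))" for B
      have "U B1 \<inter> pos ` W2 = {}" "U B2 \<inter> pos ` W1 = {}" "U B1 \<inter> U B2 = {}"
        using v1 v2 e12 unfolding U_def by (simp_all add: disjoint_iff) metis+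
      then show ?thesis using pW unfolding drawing_def U_def[symmetric] by blast
    qed
    have E: "compact ?E" using arc_edge uvA compact_arc_image by auto
    have cp: "compact (drawing W1 B1)" "compact (drawing W2 B2)"
      using compact_drawing W by auto
    have c1E: "connected (- (drawing W1 B1 \<union> ?E))"
      by (rule Janiszewski_connected) (use cp E c1 D1E connected_Compl_edge uvA compact_imp_closed in auto)
    have meet: "(drawing W1 B1 \<union> ?E) \<inter> drawing W2 B2 = {pos v}"
      using D2E D12 by (simp add: Int_Un_distrib2)
    have "connected (- (drawing W1 B1 \<union> ?E \<union> drawing W2 B2))"
      by (rule Janiszewski_connected) (use cp E c2 c1E meet compact_imp_closed in \<open>simp_all add: compact_Un\<close>)
    moreover have "drawing W1 B1 \<union> ?E \<union> drawing W2 B2 = drawing W B"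
    proof -
      have "B = insert (u, v) (B1 \<union> B2)" using uv B0 unfolding B0_def by auto
      moreover have "W = W1 \<union> W2" unfolding W1_def W2_def by auto
      ultimately show ?thesis unfolding drawing_def by auto
    qed
    ultimately show ?thesis by simp
  qed
qed

abbreviation faces :: "('a \<times> 'a) set \<Rightarrow> complex set set" where
  "faces B \<equiv> components (- drawing V B)"

lemma path_component_drawing:
  assumes "B \<subseteq> A" "(u, v) \<in> linked B" "u \<in> V"
  shows "path_component (drawing V B) (pos u) (pos v)"
  using assms(2) unfolding linked_def
proof (induction rule: rtrancl_induct)
  case base
  then show ?case using assms(3) unfolding drawing_def by (auto simp: path_component_refl_eq)
next
  case (step x y)
  have "path_component (drawing V B) (pos x) (pos y)" if "(x, y) \<in> B" for x y
    unfolding path_component_def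
    using that assms(1) arc_edge arc_imp_path start_edge finish_edge
    by (intro exI[of _ "\<gamma> (x, y)"]) (auto simp: drawing_def)
  then show ?case using step path_component_trans path_component_sym by (metis UnE converseD)
qed

text \<open>Euler's inequality, by inserting the edges one at a time. An edge with linked ends adds
  a face; any other edge removes a class and does not reduce the number of faces.\<close>

lemma faces_lower_bound:
  assumes "B \<subseteq> A"
  shows "finite (faces B) \<and> card B + card (classes V B) + 1 \<le> card (faces B) + card V"
proof -
  have "finite B" using assms finite_A finite_subset by blast
  then show ?thesis using assms
  proof (induction B)
    case empty
    have "connected (- drawing V {})" by (rule connected_Compl_forest) (auto simp: forest_def)
    \<comment> \<open>A compact set is not the whole plane, so without edges there is exactly one
      face.\<close>
    moreover have "drawing V {} \<noteq> UNIV"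
      using compact_drawing[of V "{}"] not_compact_UNIV[where 'a = complex] by (metis empty_subsetI order_refl)
    then have "- drawing V {} \<noteq> {}" by blast
    ultimately have "faces {} = {- drawing V {}}" by (simp add: components_eq_sing_iff)
    then show ?case using card_image_le[OF finite_V] unfolding classes_def by simp
  next
    case (insert e B)
    obtain u v where e: "e = (u, v)" by force
    have B: "B \<subseteq> A" and uv: "(u, v) \<in> A - B" using insert.prems insert.hyps e by auto
    then have V: "u \<in> V" "v \<in> V" using A_subset by auto
    have IH: "finite (faces B)" "card B + card (classes V B) + 1 \<le> card (faces B) + card V"
      using insert.IH B by auto
    note glue = components_glued_arc[OF compact_drawing[OF order_refl B] _ drawing_V_Int_edge[OF B uv] IH(1),
        folded drawing_insert e]
    have ar: "arc (\<gamma> (u, v))" using uv arc_edge by auto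
    have g1: "finite (faces (insert e B))" "card (faces B) \<le> card (faces (insert e B))"
      using glue(1,2) ar e by auto
    show ?case
    proof (cases "(u, v) \<in> linked B")
      case True
      then have "card (faces B) < card (faces (insert e B))"
        using glue(3) ar path_component_drawing[OF B True V(1)] uv start_edge finish_edge e by auto
      moreover have "card (classes V (insert e B)) \<le> card (classes V B)"
        unfolding e by (rule classes_insert) (use finite_V V in auto)
      ultimately show ?thesis using g1 IH insert.hyps by simp
    next
      case False
      then have "card (classes V (insert e B)) < card (classes V B)"
        unfolding e by (intro classes_insert) (use finite_V V in auto)
      then show ?thesis using g1 IH insert.hyps by simp
    qed
  qed
qed

text \<open>The ends of the arc are left out because a face can touch an end without running along
  the edge.\<close>

definition incident :: "'a \<times> 'a \<Rightarrow> complex set \<Rightarrow> bool" where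
  "incident e F \<longleftrightarrow> frontier F \<inter> (path_image (\<gamma> e) - {pathstart (\<gamma> e), pathfinish (\<gamma> e)}) \<noteq> {}"

lemma card_incident_faces:
  assumes "e \<in> A"
  shows "card {F \<in> faces A. incident e F} \<le> 2"
proof -
  obtain u v where e: "e = (u, v)" by force
  have A: "A = insert e (A - {e})" using assms by auto
  have B: "A - {e} \<subseteq> A" "(u, v) \<in> A - (A - {e})" using assms e by auto
  from faces_at_arc(2)[OF compact_drawing[OF order_refl B(1)] _ drawing_V_Int_edge[OF B], folded drawing_insert e]
  show ?thesis using arc_edge assms e A unfolding incident_def by simp
qed

text \<open>If the edges around \<open>F\<close> form a forest, the complement of their drawing is
  connected. As that drawing contains the frontier of \<open>F\<close>, its complement lies in
  \<open>F\<close>, so there are no other edges. Hence, unless the whole graph is a forest, the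
  edges around each face contain a cycle.\<close>

lemma incident_edges_not_forest:
  assumes F: "F \<in> faces A" and fo: "forest {e \<in> A. incident e F}"
  shows "forest A"
proof -
  define S where "S = {e \<in> A. incident e F}"
  have S: "S \<subseteq> A" unfolding S_def by auto
  have clA: "closed (drawing V A)" using compact_drawing compact_imp_closed by blast
  have con: "connected (- drawing V S)"
    using connected_Compl_forest[of V S] S A_subset fo unfolding S_def by blast
  have FA: "F \<subseteq> - drawing V A" using F in_components_subset by blast
  have SA: "drawing V S \<subseteq> drawing V A" using S unfolding drawing_def by auto
  have fr: "frontier F \<subseteq> drawing V S"
  proof
    fix p assume p: "p \<in> frontier F"
    then have "p \<in> drawing V A" using frontier_of_components_closed_complement[OF clA F] by blast
    then consider "p \<in> pos ` V" | e where "e \<in> A" "p \<in> path_image (\<gamma> e)"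
      unfolding drawing_def by blast
    then show "p \<in> drawing V S"
    proof cases
      case 2
      obtain u v where e: "e = (u, v)" by force
      show ?thesis
      proof (cases "e \<in> S")
        case False
        then have "p = pathstart (\<gamma> e) \<or> p = pathfinish (\<gamma> e)"
          using p 2 unfolding S_def incident_def by blast
        then show ?thesis using 2(1) A_subset start_edge finish_edge unfolding e drawing_def by auto
      qed (use 2 in \<open>auto simp: drawing_def\<close>)
    qed (auto simp: drawing_def)
  qed
  have "- drawing V S \<subseteq> F"
  proof (rule ccontr)
    assume "\<not> ?thesis"
    moreover have "- drawing V S \<inter> F \<noteq> {}"
      using FA SA in_components_nonempty[OF F] by blast
    ultimately have "- drawing V S \<inter> frontier F \<noteq> {}"
      using connected_Int_frontier[OF con, of F] by blast
    then show False using fr by blast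
  qed
  then have AS: "drawing V A \<subseteq> drawing V S" using FA by blast
  \<comment> \<open>An edge outside \<open>S\<close> would be covered by the drawing of
    \<open>S\<close> but meet it only in its two ends, while the midpoint of its arc is neither of
    them.\<close>
  have "A \<subseteq> S"
  proof
    fix e assume eA: "e \<in> A"
    obtain u v where e: "e = (u, v)" by force
    show "e \<in> S"
    proof (rule ccontr)
      assume "e \<notin> S"
      then have "drawing V S \<inter> path_image (\<gamma> e) = {pathstart (\<gamma> e), pathfinish (\<gamma> e)}"
        using drawing_V_Int_edge[OF S, of u v] eA e by auto
      moreover have "path_image (\<gamma> e) \<subseteq> drawing V S" using AS eA unfolding drawing_def by blast
      moreover have "\<gamma> e (1/2) \<in> path_image (\<gamma> e)" unfolding path_image_def by auto
      ultimately have "\<gamma> e (1/2) = \<gamma> e 0 \<or> \<gamma> e (1/2) = \<gamma> e 1"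
        unfolding pathstart_def pathfinish_def by blast
      moreover have "inj_on (\<gamma> e) {0..1}" using arc_edge eA e unfolding arc_def by blast
      ultimately show False unfolding inj_on_def by force
    qed
  qed
  then show ?thesis using fo S unfolding S_def by (simp add: subset_antisym)
qed

text \<open>Unless \<open>A\<close> is a forest, at least \<open>g\<close> edges border each face
  and at most two faces border each edge. Double counting bounds the number of faces from above, and
  Euler's inequality bounds it from below.\<close>

theorem plane_edge_bound:
  assumes V: "V \<noteq> {}" and g: "\<And>B. B \<subseteq> A \<Longrightarrow> \<not> forest B \<Longrightarrow> g \<le> card B"
  shows "card A < card V \<or> g * (card A + 2) \<le> 2 * card A + g * card V"
proof -
  have cl: "1 \<le> card (classes V A)"
    using V finite_V unfolding classes_def by (simp add: Suc_le_eq card_gt_0_iff)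
  show ?thesis
  proof (cases "forest A")
    case True
    then show ?thesis using card_forest[OF finite_V A_subset True] cl by simp
  next
    case False
    have fin: "finite (faces A)" and lb: "card A + 2 \<le> card (faces A) + card V"
      using faces_lower_bound[of A] cl by auto
    have "g * card (faces A) = (\<Sum>F\<in>faces A. g)" by simp
    also have "\<dots> \<le> (\<Sum>F\<in>faces A. card {e \<in> A. incident e F})"
    proof (rule sum_mono)
      fix F assume "F \<in> faces A"
      then show "g \<le> card {e \<in> A. incident e F}"
        using incident_edges_not_forest False by (intro g) auto
    qed
    also have "\<dots> = (\<Sum>F\<in>faces A. \<Sum>e\<in>A. if incident e F then 1 else 0)"
      using finite_A by (intro sum.cong refl) (simp add: sum.If_cases Int_def)
    also have "\<dots> = (\<Sum>e\<in>A. \<Sum>F\<in>faces A. if incident e F then 1 else 0)" by (rule sum.swap)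
    also have "\<dots> = (\<Sum>e\<in>A. card {F \<in> faces A. incident e F})"
      using fin by (intro sum.cong refl) (simp add: sum.If_cases Int_def)
    also have "\<dots> \<le> (\<Sum>e\<in>A. 2)" by (intro sum_mono card_incident_faces)
    finally have "g * card (faces A) \<le> 2 * card A" by simp
    moreover have "g * (card A + 2) \<le> g * (card (faces A) + card V)" using lb by (rule mult_le_mono2)
    ultimately show ?thesis by (simp add: distrib_left)
  qed
qed

end

section \<open>Girth and the density of planar graphs\<close>

lemma linked_imp_path:
  assumes "(u, v) \<in> linked B"
  obtains xs where "distinct xs" "xs \<noteq> []" "hd xs = u" "last xs = v"
    "successively (\<lambda>x y. (x, y) \<in> B \<union> B\<inverse>) xs"
proof -
  have "\<exists>xs. distinct xs \<and> xs \<noteq> [] \<and> hd xs = u \<and> last xs = v \<and>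
      successively (\<lambda>x y. (x, y) \<in> B \<union> B\<inverse>) xs"
    using assms unfolding linked_def
  proof (induction rule: converse_rtrancl_induct)
    case base
    show ?case by (rule exI[of _ "[v]"]) simp
  next
    case (step x y)
    then obtain xs where xs: "distinct xs" "xs \<noteq> []" "hd xs = y" "last xs = v"
      "successively (\<lambda>x y. (x, y) \<in> B \<union> B\<inverse>) xs" by blast
    show ?case
    proof (cases "x \<in> set xs")
      case True
      \<comment> \<open>If \<open>x\<close> has been visited already, the detour before its
        occurrence is cut off.\<close>
      then obtain ys zs where "xs = ys @ x # zs" by (meson split_list)
      then show ?thesis using xs by (intro exI[of _ "x # zs"]) (auto simp: successively_append_iff)
    next
      case False
      then show ?thesis using xs step(1) by (intro exI[of _ "x # xs"]) (auto simp: successively_Cons)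
    qed
  qed
  then show thesis using that by blast
qed

text \<open>The list visits no vertex twice, so its consecutive pairs come from distinct edges of
  \<open>B\<close>.\<close>

lemma path_length_le:
  assumes "finite B" "distinct xs" "successively (\<lambda>x y. (x, y) \<in> B \<union> B\<inverse>) xs"
  shows "length xs \<le> card B + 1"
proof -
  define n where "n = length xs - 1"
  have "\<exists>e\<in>B. e = (xs ! i, xs ! Suc i) \<or> e = (xs ! Suc i, xs ! i)" if "i < n" for i
  proof -
    have "Suc i < length xs" using that unfolding n_def by simp
    from successively_conv_nth[THEN iffD1, OF assms(3), rule_format, OF this] show ?thesis by auto
  qed
  then obtain f where f: "\<And>i. i < n \<Longrightarrow> f i \<in> B"
      "\<And>i. i < n \<Longrightarrow> f i = (xs ! i, xs ! Suc i) \<or> f i = (xs ! Suc i, xs ! i)"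
    by metis
  have "inj_on f {..<n}"
  proof (rule inj_onI)
    fix i j assume ij: "i \<in> {..<n}" "j \<in> {..<n}" "f i = f j"
    then have len: "i < length xs" "Suc i < length xs" "j < length xs" "Suc j < length xs"
      unfolding n_def by auto
    have "(xs ! i = xs ! j \<and> xs ! Suc i = xs ! Suc j) \<or> (xs ! i = xs ! Suc j \<and> xs ! Suc i = xs ! j)"
      using f(2)[of i] f(2)[of j] ij by auto
    then have "i = j \<or> (i = Suc j \<and> Suc i = j)"
      using len by (auto simp: nth_eq_iff_index_eq[OF assms(2)])
    then show "i = j" by auto
  qed
  then have "card {..<n} \<le> card B" using f(1) assms(1) by (intro card_inj_on_le) auto
  then show ?thesis unfolding n_def by simp
qed

text \<open>Zipping a list of vertices with its shift by one gives the list of arcs of a walk, the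
  form in which the library states cycles.\<close>

lemma closed_walk_zip:
  assumes "successively (\<lambda>x y. (x, y) \<in> E) (x # xs)" "(last (x # xs), y) \<in> E"
  shows "pcas x (zip (x # xs) (xs @ [y])) y \<and> pawalk_verts x (zip (x # xs) (xs @ [y])) = x # xs @ [y] \<and>
    set (zip (x # xs) (xs @ [y])) \<subseteq> E"
  using assms by (induction xs arbitrary: x) (auto simp: successively_Cons split: if_splits)

lemma girth_le_length:
  assumes G: "pair_wf_digraph G" and xs: "distinct xs" "3 \<le> length xs"
    "successively (\<lambda>x y. (x, y) \<in> parcs G) xs" "(last xs, hd xs) \<in> parcs G"
  shows "girth G \<le> enat (length xs)"
proof -
  interpret pair_wf_digraph G by (rule G)
  obtain x ys where x: "xs = x # ys" using xs(2) by (cases xs) auto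
  define p where "p = zip (x # ys) (ys @ [x])"
  have p: "pcas x p x" "pawalk_verts x p = x # ys @ [x]" "set p \<subseteq> parcs G"
    using closed_walk_zip[of "parcs G" x ys x] xs unfolding x p_def by auto
  have "x \<in> pverts G" using xs(4) in_arcsD2 unfolding x by simp
  then have "cycle p"
    unfolding cycle_def awalk_def using p xs(1) unfolding x by (auto simp: p_def)
  moreover have "length p = length xs" unfolding p_def x by simp
  ultimately show ?thesis
    unfolding girth_def using xs(2) by (intro Inf_lower CollectI exI[of _ p]) auto
qed

lemma pair_graph_wf: "pair_graph G \<Longrightarrow> pair_wf_digraph G"
  unfolding pair_graph_def pair_digraph_def pair_fin_digraph_def by blast

lemma pair_graph_arcs:
  assumes "pair_graph G"
  shows "finite (parcs G)" "sym (parcs G)" "irrefl (parcs G)" "parcs G \<subseteq> pverts G \<times> pverts G"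
proof -
  interpret pair_graph G by (rule assms)
  show "finite (parcs G)" by (rule pair_finite_arcs)
  show "sym (parcs G)" using arcs_symmetric by (auto intro: symI)
  show "irrefl (parcs G)"
  proof (rule irreflI)
    fix a show "(a, a) \<notin> parcs G" using pair_no_loops[of "(a, a)"] by auto
  qed
  show "parcs G \<subseteq> pverts G \<times> pverts G" using in_arcsD1 in_arcsD2 by auto
qed

text \<open>An edge whose ends remain linked without it closes a path to a cycle with edges from
  \<open>A\<close>. As \<open>A\<close> contains no reversed pairs, the path has at least three
  vertices, so the cycle counts for the girth.\<close>

lemma girth_le_card_if_not_forest:
  assumes G: "pair_graph G" and A: "A \<subseteq> parcs G" "A \<inter> A\<inverse> = {}" and nf: "\<not> forest A"
  shows "girth G \<le> enat (card A)"
proof -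
  interpret pair_graph G by (rule G)
  have sym: "(y, x) \<in> parcs G" if "(x, y) \<in> parcs G" for x y
    using that arcs_symmetric by auto
  have finA: "finite A" using A(1) pair_finite_arcs finite_subset by blast
  obtain u v where uv: "(u, v) \<in> A" "(u, v) \<in> linked (A - {(u, v)})"
    using nf unfolding forest_def by auto
  define B where "B = A - {(u, v)}"
  obtain xs where xs: "distinct xs" "xs \<noteq> []" "hd xs = u" "last xs = v"
    "successively (\<lambda>x y. (x, y) \<in> B \<union> B\<inverse>) xs"
    using linked_imp_path uv(2) unfolding B_def by metis
  have BG: "B \<union> B\<inverse> \<subseteq> parcs G" using A(1) sym unfolding B_def by auto
  have "u \<noteq> v" using uv(1) A(2) by auto
  have len3: "3 \<le> length xs"
  proof (rule ccontr)
    assume "\<not> 3 \<le> length xs"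
    moreover have "0 < length xs" using xs(2) by simp
    ultimately have "length xs = 1 \<or> length xs = 2" by linarith
    then show False
    proof
      assume "length xs = 1"
      then show False using xs(3,4) \<open>u \<noteq> v\<close> by (auto simp: length_Suc_conv)
    next
      assume "length xs = 2"
      then have "xs = [u, v]" using xs(3,4) by (auto simp: length_Suc_conv numeral_2_eq_2)
      then have "(v, u) \<in> A" using xs(5) unfolding B_def by auto
      then show False using uv(1) A(2) by auto
    qed
  qed
  have "length xs \<le> card B + 1" using finA xs(1,5) unfolding B_def by (intro path_length_le) auto
  then have lenA: "length xs \<le> card A"
    using card.remove[OF finA uv(1)] unfolding B_def by simp
  have "girth G \<le> enat (length xs)"
  proof (rule girth_le_length[OF pair_wf_digraph_axioms xs(1) len3])
    show "successively (\<lambda>x y. (x, y) \<in> parcs G) xs"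
      by (rule successively_mono[OF xs(5)]) (use BG in auto)
    show "(last xs, hd xs) \<in> parcs G" using xs(3,4) uv(1) A(1) sym by auto
  qed
  also have "\<dots> \<le> enat (card A)" using lenA by simp
  finally show ?thesis .
qed

text \<open>An injective numbering of the vertices orients each edge from its smaller to its larger
  end.\<close>

lemma half_of_sym:
  assumes "finite E" "sym E" "irrefl E"
  obtains A where "A \<subseteq> E" "A \<inter> A\<inverse> = {}" "card E = 2 * card A"
proof -
  obtain i :: "'a \<Rightarrow> nat" where i: "inj_on i (Field E)"
    using finite_imp_inj_to_nat_seg[OF finite_Field[OF assms(1)]] by blast
  define A where "A = {(u, v) \<in> E. i u < i v}"
  have "E = A \<union> A\<inverse>"
  proof
    show "A \<union> A\<inverse> \<subseteq> E" using assms(2) unfolding A_def by (auto dest: symD)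
    show "E \<subseteq> A \<union> A\<inverse>"
    proof (rule subrelI)
      fix u v assume uv: "(u, v) \<in> E"
      then have "u \<noteq> v" "u \<in> Field E" "v \<in> Field E"
        using assms(3) unfolding irrefl_def by (auto intro: FieldI1 FieldI2)
      then have "i u < i v \<or> i v < i u" using inj_onD[OF i, of u v] by linarith
      then show "(u, v) \<in> A \<union> A\<inverse>" using uv symD[OF assms(2) uv] unfolding A_def by auto
    qed
  qed
  moreover have disj: "A \<inter> A\<inverse> = {}" unfolding A_def by auto
  moreover have "finite A" using assms(1) unfolding A_def by (rule rev_finite_subset) auto
  ultimately have "card E = card A + card (A\<inverse>)"
    by (metis card_Un_disjoint finite_converse)
  then have "card E = 2 * card A" by (simp add: card_inverse)
  moreover have "A \<subseteq> E" unfolding A_def by auto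
  ultimately show thesis using that disj by blast
qed

text \<open>The edge bound passes to subgraphs, whose cycles are cycles of \<open>G\<close>. The
  vertices counted are the ends of \<open>E\<close>, and the bound appears doubled because
  \<open>E\<close> holds both directions of each edge.\<close>

lemma planar_sparse:
  assumes G: "pair_graph G" "planar G" and g: "enat g \<le> girth G"
    and E: "E \<subseteq> parcs G" "sym E" "E \<noteq> {}"
  shows "card E < 2 * card (fst ` E) \<or> g * (card E + 4) \<le> 2 * card E + 2 * g * card (fst ` E)"
proof -
  obtain pos \<gamma> where d: "plane_drawing G pos \<gamma>" using G(2) unfolding planar_def by blast
  note d1 = d[unfolded plane_drawing_def, THEN conjunct1]
    and d2 = d[unfolded plane_drawing_def, THEN conjunct2, THEN conjunct1]
    and d3 = d[unfolded plane_drawing_def, THEN conjunct2, THEN conjunct2, THEN conjunct1]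
    and d4 = d[unfolded plane_drawing_def, THEN conjunct2, THEN conjunct2, THEN conjunct2]
  have fin: "finite E" using E(1) pair_graph_arcs(1)[OF G(1)] by (rule finite_subset)
  have irr: "irrefl E" using E(1) pair_graph_arcs(3)[OF G(1)] unfolding irrefl_def by blast
  obtain A where A: "A \<subseteq> E" "A \<inter> A\<inverse> = {}" "card E = 2 * card A"
    using half_of_sym[OF fin E(2) irr] .
  have AG: "A \<subseteq> parcs G" using A E by auto
  have VG: "fst ` E \<subseteq> pverts G" using E(1) pair_graph_arcs(4)[OF G(1)] by auto
  interpret plane_arcs "fst ` E" pos \<gamma> A
  proof
    show "finite (fst ` E)" using fin by simp
    show "A \<subseteq> fst ` E \<times> fst ` E"
    proof (rule subrelI)
      fix u v assume "(u, v) \<in> A"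
      then have "(u, v) \<in> E" "(v, u) \<in> E" using A(1) E(2) by (auto dest: symD)
      then show "(u, v) \<in> fst ` E \<times> fst ` E"
        using image_eqI[of u fst "(u, v)" E] image_eqI[of v fst "(v, u)" E] by simp
    qed
    show "inj_on pos (fst ` E)" using d1 VG by (rule inj_on_subset)
    fix u v assume uv: "(u, v) \<in> A"
    then have uvG: "(u, v) \<in> parcs G" using AG by blast
    show "arc (\<gamma> (u, v))" "pathstart (\<gamma> (u, v)) = pos u" "pathfinish (\<gamma> (u, v)) = pos v"
      using d2[THEN bspec, OF uvG] by auto
    show "w = u \<or> w = v" if "w \<in> fst ` E" "pos w \<in> path_image (\<gamma> (u, v))" for w
      using d3[THEN bspec, OF uvG, unfolded prod.case, THEN bspec, OF subsetD[OF VG that(1)]] that(2) by blast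
    fix x y assume xy: "(x, y) \<in> A" "(u, v) \<noteq> (x, y)"
    then have xyG: "(x, y) \<in> parcs G" using AG by blast
    have "{u, v} \<noteq> {x, y}" using xy uv A(2) by (auto simp: doubleton_eq_iff)
    then show "path_image (\<gamma> (u, v)) \<inter> path_image (\<gamma> (x, y)) \<subseteq> pos ` ({u, v} \<inter> {x, y})"
      using d4[THEN bspec, OF uvG, unfolded prod.case, THEN bspec, OF xyG] by simp
  qed
  have "card A < card (fst ` E) \<or> g * (card A + 2) \<le> 2 * card A + g * card (fst ` E)"
  proof (rule plane_edge_bound)
    show "fst ` E \<noteq> {}" using E(3) by simp
    fix B assume B: "B \<subseteq> A" "\<not> forest B"
    have "girth G \<le> enat (card B)"
      by (rule girth_le_card_if_not_forest[OF G(1) _ _ B(2)]) (use B(1) AG A(2) in auto)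
    with g have "enat g \<le> enat (card B)" by (rule order_trans)
    then show "g \<le> card B" by simp
  qed
  then show ?thesis unfolding A(3) by (auto simp: algebra_simps)
qed

section \<open>Vector labellings of sparse graphs\<close>

text \<open>Vectors over the field with two elements are represented by their supports: addition is
  symmetric difference, and the inner product \<open>dot\<close> is the parity of the common
  support.\<close>

definition vadd :: "nat set \<Rightarrow> nat set \<Rightarrow> nat set" where
  "vadd x y = (x - y) \<union> (y - x)"

definition dot :: "nat set \<Rightarrow> nat set \<Rightarrow> bool" where
  "dot x y \<longleftrightarrow> odd (card (x \<inter> y))"

lemma dot_commute: "dot x y = dot y x"
  unfolding dot_def by (simp add: Int_commute)

lemma dot_vadd:
  assumes "finite x" "finite y"
  shows "dot z (vadd x y) \<longleftrightarrow> dot z x \<noteq> dot z y"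
proof -
  have x: "card (z \<inter> x) = card (z \<inter> (x - y)) + card (z \<inter> (x \<inter> y))"
    using assms by (subst card_Un_disjoint[symmetric]) (auto intro!: arg_cong[of _ _ card])
  have y: "card (z \<inter> y) = card (z \<inter> (y - x)) + card (z \<inter> (x \<inter> y))"
    using assms by (subst card_Un_disjoint[symmetric]) (auto intro!: arg_cong[of _ _ card])
  have xy: "card (z \<inter> vadd x y) = card (z \<inter> (x - y)) + card (z \<inter> (y - x))"
    unfolding vadd_def using assms by (subst card_Un_disjoint[symmetric]) (auto intro!: arg_cong[of _ _ card])
  show ?thesis unfolding dot_def x y xy by auto
qed

lemma vadd_cancel: "vadd a (vadd a x) = x"
  unfolding vadd_def by auto

section \<open>Linear systems over the field with two elements\<close>

definition solutions :: "nat \<Rightarrow> 'i set \<Rightarrow> ('i \<Rightarrow> nat set) \<Rightarrow> ('i \<Rightarrow> bool) \<Rightarrow> nat set set" where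
  "solutions k I a b = {x. x \<subseteq> {..<k} \<and> (\<forall>i\<in>I. dot (a i) x = b i)}"

text \<open>
  For a nonempty solution set \<open>S\<close> of a linear system, these are the linear combinations of its left-hand sides;
  any other equation can be added to the system without losing solvability.
\<close>

definition fixed_forms :: "nat \<Rightarrow> nat set set \<Rightarrow> nat set set" where
  "fixed_forms k S = {c. c \<subseteq> {..<k} \<and> (\<exists>\<beta>. \<forall>x\<in>S. dot c x = \<beta>)}"

lemma finite_solutions: "finite (solutions k I a b)"
  unfolding solutions_def by (rule finite_subset[of _ "Pow {..<k}"]) auto

lemma finite_fixed_forms: "finite (fixed_forms k S)"
  unfolding fixed_forms_def by (rule finite_subset[of _ "Pow {..<k}"]) auto

lemma empty_in_fixed_forms: "{} \<in> fixed_forms k S"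
  unfolding fixed_forms_def dot_def by (auto intro: exI[of _ False])

lemma solutions_insert:
  "solutions k (insert i I) a b = {x \<in> solutions k I a b. dot (a i) x = b i}"
  unfolding solutions_def by auto

lemma dot_vadd3:
  assumes "x \<subseteq> {..<k}" "y \<subseteq> {..<k}" "z \<subseteq> {..<k}"
  shows "dot c (vadd x (vadd y z)) \<longleftrightarrow> (dot c x \<noteq> (dot c y \<noteq> dot c z))"
proof -
  have "finite x" "finite y" "finite z" using assms finite_subset by blast+
  moreover then have "finite (vadd y z)" unfolding vadd_def by simp
  ultimately show ?thesis by (simp add: dot_vadd)
qed

text \<open>Over the field with two elements, a sum of three points is an affine
  combination.\<close>

lemma solutions_affine:
  assumes "x \<in> solutions k I a b" "y \<in> solutions k I a b" "z \<in> solutions k I a b"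
  shows "vadd x (vadd y z) \<in> solutions k I a b"
proof -
  have "vadd x (vadd y z) \<subseteq> {..<k}"
    using assms unfolding solutions_def vadd_def by auto
  then show ?thesis using assms unfolding solutions_def by (auto simp: dot_vadd3)
qed

text \<open>A further equation at most halves the solution set: if \<open>x0\<close> satisfies it
  and \<open>x1\<close> violates it, adding both maps the violating solutions injectively to
  satisfying ones.\<close>

lemma card_solutions:
  assumes "finite I" "solutions k I a b \<noteq> {}"
  shows "2 ^ k \<le> 2 ^ card I * card (solutions k I a b)"
  using assms
proof (induction I)
  case empty
  have "solutions k {} a b = Pow {..<k}" unfolding solutions_def by auto
  then show ?case by (simp add: card_Pow)
next
  case (insert i I)
  define S where "S = solutions k I a b"
  define T where "T = solutions k (insert i I) a b"
  have TS: "T = {x \<in> S. dot (a i) x = b i}" unfolding S_def T_def by (rule solutions_insert)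
  obtain x0 where x0: "x0 \<in> T" using insert.prems unfolding T_def by auto
  have fin: "finite S" "finite T" unfolding S_def T_def by (auto simp: finite_solutions)
  have sub: "x \<subseteq> {..<k}" if "x \<in> S" for x using that unfolding S_def solutions_def by auto
  have "card (S - T) \<le> card T"
  proof (cases "S - T = {}")
    case False
    then obtain x1 where x1: "x1 \<in> S - T" by auto
    have mem: "x0 \<in> S" "x1 \<in> S" using x0 x1 TS by auto
    show ?thesis
    proof (rule card_inj_on_le[of "\<lambda>y. vadd x0 (vadd x1 y)"])
      show "inj_on (\<lambda>y. vadd x0 (vadd x1 y)) (S - T)"
        by (rule inj_on_inverseI[where g = "\<lambda>z. vadd x1 (vadd x0 z)"]) (simp add: vadd_cancel)
      show "(\<lambda>y. vadd x0 (vadd x1 y)) ` (S - T) \<subseteq> T"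
      proof (intro image_subsetI)
        fix y assume y: "y \<in> S - T"
        then have "vadd x0 (vadd x1 y) \<in> S"
          using mem solutions_affine unfolding S_def by blast
        moreover have "dot (a i) (vadd x0 (vadd x1 y)) = b i"
          using dot_vadd3[OF sub[OF mem(1)] sub[OF mem(2)] sub, of y "a i"] x0 x1 y unfolding TS by auto
        ultimately show "vadd x0 (vadd x1 y) \<in> T" unfolding TS by simp
      qed
    qed (rule fin)
  qed (simp only: card.empty zero_le)
  moreover have "card S = card T + card (S - T)"
    using fin TS by (subst card_Un_disjoint[symmetric]) (auto intro: arg_cong[of _ _ card])
  ultimately have "card S \<le> 2 * card T" by simp
  moreover have "2 ^ k \<le> 2 ^ card I * card S"
    using insert.IH x0 TS unfolding S_def by blast
  ultimately have "2 ^ k \<le> 2 ^ card I * (2 * card T)"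
    by (meson le_trans mult_le_mono2)
  then show ?case using insert.hyps unfolding T_def by simp
qed

text \<open>A further equation at most doubles the number of fixed forms. A form constant on the
  smaller solution set \<open>T\<close> is constant on \<open>S\<close> or takes the other value on
  all of \<open>S - T\<close>; in the second case adding \<open>a i\<close> makes it constant on
  \<open>S\<close>.\<close>

lemma card_fixed_forms:
  assumes "finite I" "solutions k I a b \<noteq> {}" "\<And>i. i \<in> I \<Longrightarrow> a i \<subseteq> {..<k}"
  shows "card (fixed_forms k (solutions k I a b)) \<le> 2 ^ card I"
  using assms
proof (induction I)
  case empty
  have "c = {}" if c: "c \<in> fixed_forms k (solutions k {} a b)" for c
  proof (rule ccontr)
    assume "c \<noteq> {}"
    then obtain i where i: "i \<in> c" by auto
    have ck: "c \<subseteq> {..<k}" using c unfolding fixed_forms_def by auto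
    have "{} \<in> solutions k {} a b" "{i} \<in> solutions k {} a b"
      using i ck unfolding solutions_def by auto
    then have "dot c {} = dot c {i}" using c unfolding fixed_forms_def by blast
    then show False using i unfolding dot_def by simp
  qed
  then have "fixed_forms k (solutions k {} a b) \<subseteq> {{}}" by blast
  then have "card (fixed_forms k (solutions k {} a b)) \<le> card {{} :: nat set}"
    by (intro card_mono) auto
  then show ?case by simp
next
  case (insert i I)
  define S where "S = solutions k I a b"
  define T where "T = solutions k (insert i I) a b"
  have TS: "T = {x \<in> S. dot (a i) x = b i}" unfolding S_def T_def by (rule solutions_insert)
  obtain x0 where x0: "x0 \<in> T" using insert.prems unfolding T_def by auto
  have sub: "x \<subseteq> {..<k}" if "x \<in> S" for x using that unfolding S_def solutions_def by auto
  have ai: "a i \<subseteq> {..<k}" using insert.prems by auto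
  have "fixed_forms k T \<subseteq> fixed_forms k S \<union> vadd (a i) ` fixed_forms k S"
  proof
    fix c assume "c \<in> fixed_forms k T"
    then obtain \<gamma> where c: "c \<subseteq> {..<k}" "\<And>x. x \<in> T \<Longrightarrow> dot c x = \<gamma>"
      unfolding fixed_forms_def by auto
    show "c \<in> fixed_forms k S \<union> vadd (a i) ` fixed_forms k S"
    proof (cases "\<exists>x1\<in>S - T. dot c x1 \<noteq> \<gamma>")
      case False
      then have "dot c x = \<gamma>" if "x \<in> S" for x using c that by blast
      then show ?thesis using c unfolding fixed_forms_def by auto
    next
      case True
      then obtain x1 where x1: "x1 \<in> S" "x1 \<notin> T" "dot c x1 = (\<not> \<gamma>)" by auto
      have x0S: "x0 \<in> S" using x0 TS by auto
      \<comment> \<open>The sum of \<open>x0\<close>, \<open>x1\<close> and \<open>x\<close> lies in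
        \<open>T\<close>, where the value of \<open>c\<close> is known; this determines the value at
        \<open>x\<close>.\<close>
      have other: "dot c x = (\<not> \<gamma>)" if x: "x \<in> S" "x \<notin> T" for x
      proof -
        have "vadd x0 (vadd x1 x) \<in> S" using solutions_affine x x1 x0S unfolding S_def by blast
        moreover have "dot (a i) (vadd x0 (vadd x1 x)) = b i"
          using dot_vadd3[OF sub[OF x0S] sub[OF x1(1)] sub[OF x(1)], of "a i"] x0 x1 x unfolding TS by auto
        ultimately have "dot c (vadd x0 (vadd x1 x)) = \<gamma>" using c(2) TS by blast
        then show ?thesis
          using dot_vadd3[OF sub[OF x0S] sub[OF x1(1)] sub[OF x(1)], of c] c(2)[OF x0] x1(3) by auto
      qed
      have "dot (vadd (a i) c) x = (b i \<noteq> \<gamma>)" if "x \<in> S" for x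
      proof -
        have "finite (a i)" "finite c" using ai c(1) finite_subset by blast+
        then have "dot (vadd (a i) c) x \<longleftrightarrow> dot (a i) x \<noteq> dot c x"
          using dot_vadd dot_commute by metis
        then show ?thesis using other[OF that] c(2)[of x] that TS by blast
      qed
      moreover have "vadd (a i) c \<subseteq> {..<k}" using ai c(1) unfolding vadd_def by auto
      ultimately have "vadd (a i) c \<in> fixed_forms k S" unfolding fixed_forms_def by blast
      then have "c \<in> vadd (a i) ` fixed_forms k S" by (rule image_eqI[rotated]) (simp add: vadd_cancel)
      then show ?thesis by blast
    qed
  qed
  then have "card (fixed_forms k T) \<le> card (fixed_forms k S \<union> vadd (a i) ` fixed_forms k S)"
    by (intro card_mono) (auto simp: finite_fixed_forms)
  also have "\<dots> \<le> card (fixed_forms k S) + card (vadd (a i) ` fixed_forms k S)"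
    by (rule card_Un_le)
  also have "\<dots> \<le> card (fixed_forms k S) + card (fixed_forms k S)"
    by (intro add_left_mono card_image_le finite_fixed_forms)
  also have "\<dots> \<le> 2 ^ card I + 2 ^ card I"
    using insert.IH insert.prems x0 TS unfolding S_def by (intro add_mono) blast+
  finally show ?case using insert.hyps unfolding T_def by simp
qed

section \<open>Extending labellings\<close>

text \<open>Labels are nonzero so that any prescribed product with a single labelled vertex can be
  attained.\<close>

definition dot_labelling ::
    "nat \<Rightarrow> ('a \<times> 'a) set \<Rightarrow> ('a \<Rightarrow> 'a \<Rightarrow> bool) \<Rightarrow> ('a \<Rightarrow> nat set) \<Rightarrow> bool" where
  "dot_labelling k E \<pi> f \<longleftrightarrow>
     (\<forall>v. f v \<subseteq> {..<k} \<and> f v \<noteq> {}) \<and> (\<forall>(u, v)\<in>E. dot (f u) (f v) = \<pi> u v)"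

text \<open>A solvable system of fewer than \<open>k\<close> equations has at least two solutions,
  by \<open>card_solutions\<close>.\<close>

lemma nonempty_solution:
  assumes "finite I" "card I < k" "solutions k I a b \<noteq> {}"
  obtains x where "x \<in> solutions k I a b" "x \<noteq> {}"
proof -
  have "2 ^ k \<le> 2 ^ card I * card (solutions k I a b)" by (rule card_solutions[OF assms(1,3)])
  moreover have "(2::nat) ^ card I < 2 ^ k" using assms(2) by simp
  ultimately have "\<not> card (solutions k I a b) \<le> card {{} :: nat set}"
    using assms(3) finite_solutions[of k I a b] by (intro notI) (simp add: le_Suc_eq)
  then have "\<not> solutions k I a b \<subseteq> {{}}" using card_mono[of "{{}}" "solutions k I a b"] by blast
  then obtain x where "x \<in> solutions k I a b" "x \<noteq> {}" by (auto simp: subset_iff)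
  then show thesis by (rule that)
qed

lemma extend_pendant:
  assumes E: "sym E" "irrefl E" and \<pi>: "\<And>x y. \<pi> x y = \<pi> y x"
    and v: "E `` {v} = {u}" and k: "2 \<le> k"
    and f: "dot_labelling k (E - {(u, v), (v, u)}) \<pi> f"
  shows "\<exists>f. dot_labelling k E \<pi> f"
proof -
  have fu: "f u \<subseteq> {..<k}" "f u \<noteq> {}" using f unfolding dot_labelling_def by auto
  then obtain i where i: "i \<in> f u" by auto
  \<comment> \<open>As \<open>f u\<close> contains \<open>i\<close>, the vector \<open>{i}\<close>
    has product 1 with it, and the zero vector has product 0.\<close>
  have "(if \<pi> u v then {i} else {}) \<in> solutions k {u} f (\<lambda>w. \<pi> w v)"
    using i fu unfolding solutions_def dot_def by auto
  then have "solutions k {u} f (\<lambda>w. \<pi> w v) \<noteq> {}" by blast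
  then obtain y where y: "y \<in> solutions k {u} f (\<lambda>w. \<pi> w v)" "y \<noteq> {}"
    using nonempty_solution[of "{u}" k f] k by auto
  have vu: "(v, u) \<in> E" "u \<noteq> v" using v E(2) unfolding irrefl_def by auto
  have only: "w = u" if "(v, w) \<in> E" for w using that v by auto
  have uv: "dot (f u) y = \<pi> u v" using y unfolding solutions_def by auto
  have "dot ((f(v := y)) a) ((f(v := y)) b) = \<pi> a b" if ab: "(a, b) \<in> E" for a b
  proof -
    consider "a = v" | "b = v" "a \<noteq> v" | "a \<noteq> v" "b \<noteq> v" by blast
    then show ?thesis
    proof cases
      case 1
      then have "b = u" using only ab by blast
      then show ?thesis using 1 uv vu(2) \<pi>[of u v] dot_commute[of "f u" y] by simp
    next
      case 2
      then have "a = u" using only ab E(1) by (meson symE)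
      then show ?thesis using 2 uv by simp
    next
      case 3
      then show ?thesis using f ab unfolding dot_labelling_def by auto
    qed
  qed
  moreover have "(f(v := y)) a \<subseteq> {..<k} \<and> (f(v := y)) a \<noteq> {}" for a
    using f y unfolding dot_labelling_def solutions_def by auto
  ultimately have "dot_labelling k E \<pi> (f(v := y))" unfolding dot_labelling_def by blast
  then show ?thesis by blast
qed

text \<open>Only \<open>u\<close> and the vertices of \<open>S\<close> get new labels. The label of
  \<open>u\<close> is taken from the solutions \<open>Z\<close> of the equations with its other
  neighbours. The equation between \<open>u\<close> and \<open>v \<in> S\<close> can then be met if
  the label of \<open>u\<close> is not constant as a form on \<open>Y v\<close>, the solutions of
  the other equations at \<open>v\<close>. The counting hypothesis makes \<open>Z\<close> larger
  than the set of excluded labels, and independence of \<open>S\<close> allows its vertices to be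
  treated separately.\<close>

lemma extend_star:
  assumes E: "finite E" "sym E" "irrefl E" and \<pi>: "\<And>x y. \<pi> x y = \<pi> y x"
    and S: "S \<subseteq> E `` {u}" "\<And>v w. v \<in> S \<Longrightarrow> w \<in> S \<Longrightarrow> (v, w) \<notin> E"
    and small: "\<And>v. v \<in> S \<Longrightarrow> card (E `` {v}) \<le> 3" and k: "4 \<le> k"
    and count: "2 ^ (card (E `` {u}) - card S) * (1 + 3 * card S) < (2::nat) ^ k"
    and f: "dot_labelling k (E - {u} \<times> S - S \<times> {u}) \<pi> f"
  shows "\<exists>f. dot_labelling k E \<pi> f"
proof -
  have finN: "finite (E `` {v})" for v using E(1) by (rule finite_Image)
  have finS: "finite S" using S(1) finN finite_subset by blast
  have uS: "u \<notin> S" using S(1) E(3) unfolding irrefl_def by auto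
  have fk: "f v \<subseteq> {..<k}" "f v \<noteq> {}" for v using f unfolding dot_labelling_def by auto
  have fE: "dot (f v) (f w) = \<pi> v w" if "(v, w) \<in> E - {u} \<times> S - S \<times> {u}" for v w
    using f that unfolding dot_labelling_def by blast
  define Z where "Z = solutions k (E `` {u} - S) f (\<lambda>w. \<pi> w u)"
  define Y where "Y v = solutions k (E `` {v} - {u}) f (\<lambda>w. \<pi> w v)" for v
  have "f u \<in> Z"
    unfolding Z_def solutions_def using fk fE E(2) uS by (auto simp: sym_def)
  then have "2 ^ k \<le> 2 ^ card (E `` {u} - S) * card Z"
    unfolding Z_def using finN by (intro card_solutions) auto
  moreover have "card (E `` {u} - S) = card (E `` {u}) - card S"
    using S(1) finS by (rule card_Diff_subset[rotated])
  ultimately have "2 ^ (card (E `` {u}) - card S) * (1 + 3 * card S)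
      < 2 ^ (card (E `` {u}) - card S) * card Z" using count by simp
  then have cZ: "1 + 3 * card S < card Z" by (simp only: mult_less_cancel1)
  have fY: "f v \<in> Y v" if "v \<in> S" for v
  proof -
    have "dot (f w) (f v) = \<pi> w v" if w: "w \<in> E `` {v} - {u}" for w
    proof -
      have "(w, v) \<in> E" using w E(2) by (auto simp: sym_def)
      moreover have "w \<noteq> u" "v \<noteq> u" using w \<open>v \<in> S\<close> uS by auto
      ultimately show ?thesis by (intro fE) auto
    qed
    then show ?thesis unfolding Y_def solutions_def using fk by blast
  qed
  \<comment> \<open>Besides \<open>u\<close>, the vertex \<open>v\<close> has at most two
    neighbours, so there are at most four fixed forms, one of which is zero.\<close>
  have cF: "card (fixed_forms k (Y v) - {{}}) \<le> 3" if v: "v \<in> S" for v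
  proof -
    have "u \<in> E `` {v}" using v S(1) E(2) by (auto simp: sym_def)
    then have "card (E `` {v} - {u}) \<le> 2" using small[OF v] finN by simp
    then have "(2::nat) ^ card (E `` {v} - {u}) \<le> 2 ^ 2" by (intro power_increasing) auto
    moreover have "card (fixed_forms k (Y v)) \<le> 2 ^ card (E `` {v} - {u})"
      unfolding Y_def using fY[OF v] finN fk unfolding Y_def by (intro card_fixed_forms) auto
    ultimately show ?thesis using empty_in_fixed_forms[of k "Y v"] finite_fixed_forms[of k "Y v"] by simp
  qed
  define U where "U = (\<Union>v\<in>S. fixed_forms k (Y v) - {{}})"
  \<comment> \<open>The zero form is common to all vertices of \<open>S\<close> and is counted once;
    excluding it also keeps the label of \<open>u\<close> nonzero.\<close>
  define B where "B = insert {} U"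
  have finU: "finite U" unfolding U_def using finS finite_fixed_forms by blast
  have "card U \<le> (\<Sum>v\<in>S. card (fixed_forms k (Y v) - {{}}))"
    unfolding U_def by (rule card_UN_le[OF finS])
  also have "\<dots> \<le> (\<Sum>v\<in>S. 3)" by (intro sum_mono cF)
  finally have "card B \<le> 1 + 3 * card S" unfolding B_def using finU by (simp add: card_insert_if)
  moreover have "finite B" unfolding B_def using finU by simp
  ultimately have "\<not> Z \<subseteq> B" using cZ card_mono[of B Z] by linarith
  then obtain x where x: "x \<in> Z" "x \<notin> B" by auto
  have xk: "x \<subseteq> {..<k}" using x(1) unfolding Z_def solutions_def by auto
  have "\<exists>y. y \<noteq> {} \<and> y \<in> solutions k (E `` {v}) (f(u := x)) (\<lambda>w. \<pi> w v)" if v: "v \<in> S" for v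
  proof -
    have "x \<notin> fixed_forms k (Y v)" using x(2) v unfolding B_def U_def by blast
    then have "\<not> (\<forall>y\<in>Y v. dot x y = (\<not> \<pi> u v))"
      using xk unfolding fixed_forms_def mem_Collect_eq by blast
    then obtain y where "y \<in> Y v" "dot x y = \<pi> u v" by auto
    then have "y \<in> solutions k (E `` {v}) (f(u := x)) (\<lambda>w. \<pi> w v)"
      unfolding Y_def solutions_def by auto
    then have ne: "solutions k (E `` {v}) (f(u := x)) (\<lambda>w. \<pi> w v) \<noteq> {}" by (rule ex_in_conv[THEN iffD1, OF exI])
    \<comment> \<open>The chosen solution may be zero; at most three equations in at least four
      coordinates leave a nonzero one.\<close>
    have "card (E `` {v}) < k" using small[OF v] k by simp
    then obtain z where "z \<in> solutions k (E `` {v}) (f(u := x)) (\<lambda>w. \<pi> w v)" "z \<noteq> {}"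
      by (rule nonempty_solution[OF finN _ ne])
    then show ?thesis by (intro exI conjI)
  qed
  then obtain g where g: "\<And>v. v \<in> S \<Longrightarrow> g v \<noteq> {}"
      "\<And>v. v \<in> S \<Longrightarrow> g v \<in> solutions k (E `` {v}) (f(u := x)) (\<lambda>w. \<pi> w v)"
    by metis
  define h where "h w = (if w = u then x else if w \<in> S then g w else f w)" for w
  have hk: "h w \<subseteq> {..<k}" "h w \<noteq> {}" for w
    using fk[of w] g[of w] xk x(2) unfolding h_def B_def solutions_def by auto
  have hS: "dot (h v) (h w) = \<pi> v w" if "w \<in> S" "(v, w) \<in> E" for v w
  proof -
    have "h v = (f(u := x)) v" using that S(2) unfolding h_def by auto
    moreover have "v \<in> E `` {w}" using that E(2) by (auto simp: sym_def)
    moreover have "h w = g w" using that uS unfolding h_def by auto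
    ultimately show ?thesis using g(2)[OF that(1)] unfolding solutions_def by auto
  qed
  have hu: "dot (h v) (h u) = \<pi> v u" if "v \<notin> S" "(v, u) \<in> E" for v
  proof -
    have "v \<noteq> u" using that E(3) unfolding irrefl_def by auto
    then have "h v = f v" "h u = x" using that unfolding h_def by auto
    moreover have "v \<in> E `` {u} - S" using that E(2) by (auto simp: sym_def)
    ultimately show ?thesis using x(1) unfolding Z_def solutions_def by auto
  qed
  have one: "dot (h v) (h w) = \<pi> v w" if "(v, w) \<in> E" "w \<in> insert u S" for v w
  proof (cases "w \<in> S")
    case True
    then show ?thesis using hS that by blast
  next
    case False
    then have w: "w = u" using that by simp
    show ?thesis
    proof (cases "v \<in> S")
      case True
      then show ?thesis using hS[of v w] that E(2) \<pi> dot_commute by (metis symE)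
    next
      case False
      then show ?thesis using hu that unfolding w by blast
    qed
  qed
  have "dot (h v) (h w) = \<pi> v w" if vw: "(v, w) \<in> E" for v w
  proof (cases "w \<in> insert u S")
    case True
    then show ?thesis using one vw by blast
  next
    case False
    show ?thesis
    proof (cases "v \<in> insert u S")
      case True
      then show ?thesis using one[of w v] vw E(2) \<pi> dot_commute by (metis symE)
    next
      case F: False
      then show ?thesis using fE[of v w] vw False unfolding h_def by auto
    qed
  qed
  then have "\<forall>(v, w)\<in>E. dot (h v) (h w) = \<pi> v w" by blast
  moreover have "\<forall>v. h v \<subseteq> {..<k} \<and> h v \<noteq> {}" using hk by blast
  ultimately have "dot_labelling k E \<pi> h" unfolding dot_labelling_def by (rule conjI[rotated])
  then show ?thesis by (rule exI[of _ h])
qed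

section \<open>Discharging\<close>

text \<open>Double counting of the pairs in \<open>E\<close> whose second entry satisfies
  \<open>P\<close>. In the discharging it equates the charge given away with the charge
  received.\<close>

lemma sum_small_neighbours:
  assumes "finite E" "sym E"
  shows "(\<Sum>u\<in>fst ` E. card {v \<in> E `` {u}. P v}) = (\<Sum>v\<in>{v \<in> fst ` E. P v}. card (E `` {v}))"
proof -
  have fin: "finite (fst ` E)" "finite (E `` {v})" for v
    using assms(1) by (auto intro: finite_Image)
  have finP: "finite {v \<in> E `` {u}. P v}" for u
    by (rule finite_subset[OF _ fin(2)[of u]]) auto
  have "(\<Sum>u\<in>fst ` E. card {v \<in> E `` {u}. P v}) = card (SIGMA u : fst ` E. {v \<in> E `` {u}. P v})"
    using fin(1) finP by (intro card_SigmaI[symmetric]) blast+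
  also have "(SIGMA u : fst ` E. {v \<in> E `` {u}. P v}) = (SIGMA v : {v \<in> fst ` E. P v}. E `` {v})\<inverse>"
  proof -
    have "u \<in> fst ` E" if "(u, v) \<in> E" for u v using image_eqI[OF _ that, of u fst] by simp
    then have "(u, v) \<in> (SIGMA u : fst ` E. {v \<in> E `` {u}. P v}) \<longleftrightarrow>
        (v, u) \<in> (SIGMA v : {v \<in> fst ` E. P v}. E `` {v})" for u v
      using assms(2) unfolding mem_Sigma_iff mem_Collect_eq Image_singleton_iff by (meson symE)
    then show ?thesis by (intro set_eqI) (simp only: split_paired_all converse_iff)
  qed
  also have "card \<dots> = card (SIGMA v : {v \<in> fst ` E. P v}. E `` {v})"
    by (rule card_inverse)
  also have "\<dots> = (\<Sum>v\<in>{v \<in> fst ` E. P v}. card (E `` {v}))"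
    using fin by (intro card_SigmaI) auto
  finally show ?thesis .
qed

text \<open>
  Discharging: a vertex of degree \<open>d\<close> has charge \<open>p * d - q\<close> and gives \<open>r\<close> to each neighbour of degree at most 3.
  As \<open>E\<close> contains both directions of each edge, \<open>card E\<close> is the sum of the degrees.
\<close>

theorem sparse_dot_labelling:
  fixes E :: "('a \<times> 'a) set" and k p q r :: nat
  assumes E: "finite E" "sym E" "irrefl E" and \<pi>: "\<And>x y. \<pi> x y = \<pi> y x"
    and triangle_free: "\<And>x y z. (x, y) \<in> E \<Longrightarrow> (y, z) \<in> E \<Longrightarrow> (z, x) \<notin> E"
    and sparse: "\<And>E'. E' \<subseteq> E \<Longrightarrow> sym E' \<Longrightarrow> E' \<noteq> {} \<Longrightarrow> p * card E' < q * card (fst ` E')"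
    and k: "4 \<le> k" and q: "q \<le> 4 * p" "q \<le> 2 * (p + r)"
    and charge: "\<And>d t. 1 \<le> t \<Longrightarrow> t \<le> d \<Longrightarrow> 2 ^ k \<le> 2 ^ (d - t) * (1 + 3 * t) \<Longrightarrow>
      4 \<le> d \<and> r * t + q \<le> p * d"
  shows "\<exists>f. dot_labelling k E \<pi> f"
  using E triangle_free sparse
proof (induction "card E" arbitrary: E rule: less_induct)
  case less
  note E = less.prems(1-3)
  have IH: "\<exists>f. dot_labelling k E' \<pi> f" if "E' \<subset> E" "sym E'" for E'
  proof (rule less.hyps)
    show "card E' < card E" using that(1) E(1) by (rule psubset_card_mono[rotated])
    show "finite E'" "irrefl E'" using that(1) E(1,3) finite_subset unfolding irrefl_def by blast+
    show "sym E'" by fact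
    show "(z, x) \<notin> E'" if "(x, y) \<in> E'" "(y, z) \<in> E'" for x y z
      using that less.prems(4)[of x y z] \<open>E' \<subset> E\<close> by blast
    show "p * card F < q * card (fst ` F)" if "F \<subseteq> E'" "sym F" "F \<noteq> {}" for F
      using that less.prems(5)[of F] \<open>E' \<subset> E\<close> by blast
  qed
  have finN: "finite (E `` {v})" for v using E(1) by (rule finite_Image)
  define d where "d v = card (E `` {v})" for v
  define N where "N u = {v \<in> E `` {u}. d v \<le> 3}" for u
  define W where "W = fst ` E"
  have finW: "finite W" unfolding W_def using E(1) by simp
  \<comment> \<open>At a vertex of degree 1, or at a vertex whose small neighbours satisfy the
    counting condition, a labelling of a smaller graph extends. If there is no such vertex,
    discharging contradicts sparsity.\<close>
  consider "E = {}" | (pendant) v where "v \<in> W" "d v \<le> 1"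
    | (star) u where "u \<in> W" "N u \<noteq> {}" "2 ^ (d u - card (N u)) * (1 + 3 * card (N u)) < (2::nat) ^ k"
    | (none) "E \<noteq> {}" "\<And>v. v \<in> W \<Longrightarrow> 2 \<le> d v"
      "\<And>u. u \<in> W \<Longrightarrow> N u \<noteq> {} \<Longrightarrow> (2::nat) ^ k \<le> 2 ^ (d u - card (N u)) * (1 + 3 * card (N u))"
    by (metis Suc_1 not_less not_less_eq_eq One_nat_def)
  then show ?case
  proof cases
    case 1
    have "dot_labelling k E \<pi> (\<lambda>_. {0})" using k unfolding dot_labelling_def 1 by auto
    then show ?thesis by blast
  next
    case pendant
    then obtain u where "(v, u) \<in> E" unfolding W_def by auto
    then have u: "u \<in> E `` {v}" by simp
    have "card (E `` {v}) = 1"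
      using pendant(2) u finN[of v] unfolding d_def by (metis card_0_eq empty_iff le_less less_one)
    then have Nv: "E `` {v} = {u}" using u by (metis card_1_singletonE singletonD)
    have "E - {(u, v), (v, u)} \<subset> E" using u by auto
    moreover have "sym (E - {(u, v), (v, u)})" using E(2) unfolding sym_def by auto
    ultimately obtain f where "dot_labelling k (E - {(u, v), (v, u)}) \<pi> f" using IH by blast
    from extend_pendant[OF E(2,3) \<pi> Nv _ this] k show ?thesis by auto
  next
    case star
    let ?E = "E - {u} \<times> N u - N u \<times> {u}"
    have "?E \<subset> E" using star(2) unfolding N_def by auto
    moreover have "sym ?E" using E(2) unfolding sym_def by auto
    ultimately obtain f where f: "dot_labelling k ?E \<pi> f" using IH by blast
    show ?thesis
    proof (rule extend_star[OF E \<pi> _ _ _ k _ f])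
      show "N u \<subseteq> E `` {u}" unfolding N_def by auto
      show "(v, w) \<notin> E" if "v \<in> N u" "w \<in> N u" for v w
        using that less.prems(4)[of u v w] E(2) unfolding N_def sym_def by auto
      show "card (E `` {v}) \<le> 3" if "v \<in> N u" for v using that unfolding N_def d_def by auto
      show "2 ^ (card (E `` {u}) - card (N u)) * (1 + 3 * card (N u)) < (2::nat) ^ k"
        using star(3) unfolding d_def .
    qed
  next
    case none
    have NE: "card (N u) \<le> d u" "finite (N u)" for u
    proof -
      have "N u \<subseteq> E `` {u}" unfolding N_def by blast
      then show "card (N u) \<le> d u" "finite (N u)"
        unfolding d_def using finN[of u] by (auto intro: card_mono finite_subset)
    qed
    \<comment> \<open>\<open>r * s u\<close> is the charge that \<open>u\<close> receives: a vertex
      of degree at most 3 gets \<open>r\<close> from each of its neighbours.\<close>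
    define s where "s u = (if d u \<le> 3 then d u else 0)" for u
    \<comment> \<open>No vertex ends with negative charge. Without small neighbours, degrees 2 and 3
      are covered by \<open>q \<le> 2 * (p + r)\<close> and larger ones by
      \<open>q \<le> 4 * p\<close>; otherwise \<open>charge\<close> applies.\<close>
    have "q + r * card (N u) \<le> p * d u + r * s u" if u: "u \<in> W" for u
    proof (cases "N u = {}")
      case True
      have "q \<le> p * d u + r * s u"
      proof (cases "d u \<le> 3")
        case small: True
        have "2 * (p + r) \<le> d u * (p + r)" using none(2)[OF u] by (rule mult_le_mono1)
        then show ?thesis using q(2) small unfolding s_def by (simp add: algebra_simps)
      next
        case False
        then have "4 * p \<le> d u * p" by (intro mult_le_mono1) simp
        from order_trans[OF q(1) this] show ?thesis
          unfolding mult.commute[of "d u" p] by (rule trans_le_add1)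
      qed
      then show ?thesis using True by simp
    next
      case False
      then have "1 \<le> card (N u)" using NE by (simp add: Suc_le_eq card_gt_0_iff)
      from charge[OF this NE(1) none(3)[OF u False]] show ?thesis by simp
    qed
    then have "(\<Sum>u\<in>W. q + r * card (N u)) \<le> (\<Sum>u\<in>W. p * d u + r * s u)" by (rule sum_mono)
    then have "q * card W + r * (\<Sum>u\<in>W. card (N u)) \<le> p * (\<Sum>u\<in>W. d u) + r * (\<Sum>u\<in>W. s u)"
      by (simp add: sum.distrib sum_distrib_left mult.commute[of _ q])
    moreover have "(\<Sum>u\<in>W. card (N u)) = (\<Sum>u\<in>W. s u)"
    proof -
      have "(\<Sum>u\<in>W. s u) = (\<Sum>v\<in>{v \<in> W. d v \<le> 3}. d v)"
        unfolding s_def using finW by (simp add: sum.inter_filter)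
      then show ?thesis
        using sum_small_neighbours[OF E(1,2), of "\<lambda>v. d v \<le> 3"] unfolding N_def W_def d_def by simp
    qed
    moreover have "(\<Sum>u\<in>W. d u) = card E"
    proof -
      have "(\<Sum>u\<in>W. d u) = card (SIGMA u : W. E `` {u})"
        unfolding d_def using finW finN by (intro card_SigmaI[symmetric]) auto
      also have "(SIGMA u : W. E `` {u}) = E" unfolding W_def by force
      finally show ?thesis .
    qed
    \<comment> \<open>The transfers cancel, so the initial total charge is nonnegative.\<close>
    ultimately have "q * card W \<le> p * card E" by simp
    moreover have "p * card E < q * card W"
      using less.prems(5)[of E] E(2) none(1) unfolding W_def by simp
    ultimately show ?thesis by simp
  qed
qed

section \<open>Inversion diameter\<close>

text \<open>Each inversion set containing both ends of an arc swaps its direction, so only the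
  parity of their number matters.\<close>

lemma parcs_fold_inversion:
  "pverts (fold inversion Xs D) = pverts D \<and>
   (\<forall>u v. (u, v) \<in> parcs (fold inversion Xs D) \<longleftrightarrow>
     (if even (length (filter (\<lambda>X. u \<in> X \<and> v \<in> X) Xs)) then (u, v) \<in> parcs D else (v, u) \<in> parcs D))"
proof (induction Xs arbitrary: D)
  case Nil
  show ?case by simp
next
  case (Cons X Xs)
  have "(u, v) \<in> parcs (inversion X D) \<longleftrightarrow> (if u \<in> X \<and> v \<in> X then (v, u) \<in> parcs D else (u, v) \<in> parcs D)"
    for u v unfolding inversion_def by auto
  moreover have "pverts (inversion X D) = pverts D" unfolding inversion_def by simp
  ultimately show ?case using Cons.IH[of "inversion X D"] by (auto simp: conj_commute)
qed

lemma length_filter_upt: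
  "length (filter P [0..<k]) = card {i. i < k \<and> P i}"
  by (auto simp: length_filter_conv_card intro!: arg_cong[of _ _ card])

text \<open>The \<open>i\<close>-th inversion set consists of the vertices whose label has
  coordinate \<open>i\<close> equal to 1. An edge is thus reversed as many times as the labels of
  its ends share coordinates.\<close>

lemma inversion_diameter_le:
  fixes G :: "'a pair_pre_digraph"
  assumes G: "pair_graph G"
    and lab: "\<And>\<pi>. (\<And>x y. \<pi> x y = \<pi> y x) \<Longrightarrow> \<exists>f. dot_labelling k (parcs G) \<pi> f"
  shows "inversion_diameter G \<le> enat k"
proof -
  interpret pair_graph G by (rule G)
  have sym: "(y, x) \<in> parcs G" if "(x, y) \<in> parcs G" for x y
    using that arcs_symmetric by auto
  have "inversion_distance D D' \<le> enat k" if D: "orientation_of G D" "orientation_of G D'" for D D'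
  proof -
    \<comment> \<open>Both directions are compared so that \<pi> is symmetric on all pairs; on an
      edge it says whether the edge has to be reversed.\<close>
    define \<pi> where "\<pi> u v \<longleftrightarrow> \<not> ((u, v) \<in> parcs D \<longleftrightarrow> (u, v) \<in> parcs D') \<or>
        \<not> ((v, u) \<in> parcs D \<longleftrightarrow> (v, u) \<in> parcs D')" for u v
    have "\<pi> x y = \<pi> y x" for x y unfolding \<pi>_def by auto
    then obtain f where f: "dot_labelling k (parcs G) \<pi> f" using lab by blast
    define X where "X i = {v \<in> pverts G. i \<in> f v}" for i
    define Xs where "Xs = map X [0..<k]"
    have V: "pverts D = pverts G" "pverts D' = pverts G" using D unfolding orientation_of_def by auto
    have count: "odd (length (filter (\<lambda>X. u \<in> X \<and> v \<in> X) Xs)) \<longleftrightarrow> \<pi> u v" if uv: "(u, v) \<in> parcs G" for u v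
    proof -
      have uvV: "u \<in> pverts G" "v \<in> pverts G" using uv in_arcsD1 in_arcsD2 by auto
      have "length (filter (\<lambda>X. u \<in> X \<and> v \<in> X) Xs) = length (filter (\<lambda>i. u \<in> X i \<and> v \<in> X i) [0..<k])"
        unfolding Xs_def by (simp add: filter_map comp_def)
      also have "\<dots> = card {i. i < k \<and> u \<in> X i \<and> v \<in> X i}" by (rule length_filter_upt)
      also have "{i. i < k \<and> u \<in> X i \<and> v \<in> X i} = f u \<inter> f v"
        using f uvV unfolding X_def dot_labelling_def by auto
      finally show ?thesis using f uv unfolding dot_labelling_def dot_def by auto
    qed
    have "parcs (fold inversion Xs D) = parcs D'"
    proof (rule set_eqI, clarify)
      fix u v
      have e: "(u, v) \<in> parcs (fold inversion Xs D) \<longleftrightarrow>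
         (if even (length (filter (\<lambda>X. u \<in> X \<and> v \<in> X) Xs)) then (u, v) \<in> parcs D else (v, u) \<in> parcs D)"
        using parcs_fold_inversion[of Xs D] by blast
      show "(u, v) \<in> parcs (fold inversion Xs D) \<longleftrightarrow> (u, v) \<in> parcs D'"
      proof (cases "(u, v) \<in> parcs G")
        case True
        have "(u, v) \<in> parcs D \<longleftrightarrow> (v, u) \<notin> parcs D" "(u, v) \<in> parcs D' \<longleftrightarrow> (v, u) \<notin> parcs D'"
          using D True unfolding orientation_of_def by auto
        then show ?thesis using e count[OF True] unfolding \<pi>_def by auto
      next
        case False
        then have "(u, v) \<notin> parcs D" "(v, u) \<notin> parcs D" "(u, v) \<notin> parcs D'"
          using D sym unfolding orientation_of_def by blast+
        then show ?thesis using e by simp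
      qed
    qed
    moreover have "pverts (fold inversion Xs D) = pverts D'"
      using parcs_fold_inversion[of Xs D] V by simp
    ultimately have "fold inversion Xs D = D'" by (intro pair_pre_digraph.equality) auto
    moreover have "\<forall>Y\<in>set Xs. Y \<subseteq> pverts D" unfolding Xs_def X_def V by auto
    moreover have "length Xs = k" unfolding Xs_def by simp
    ultimately show ?thesis unfolding inversion_distance_def by (intro Inf_lower) blast
  qed
  then show ?thesis unfolding inversion_diameter_def by (intro Sup_least) auto
qed

text \<open>In \<open>density\<close>, \<open>m\<close> stands for the sum of the degrees and
  \<open>n\<close> for the number of vertices, so its conclusion says that the average degree is
  below q / p. The bound \<open>4 \<le> g\<close> excludes triangles.\<close>

lemma planar_inversion_diameter_le:
  fixes G :: "'a pair_pre_digraph" and g k p q r :: nat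
  assumes G: "pair_graph G" "planar G" and g: "4 \<le> g" "enat g \<le> girth G"
    and density: "\<And>m n :: nat. 0 < n \<Longrightarrow> m < 2 * n \<or> g * (m + 4) \<le> 2 * m + 2 * g * n \<Longrightarrow> p * m < q * n"
    and k: "4 \<le> k" and q: "q \<le> 4 * p" "q \<le> 2 * (p + r)"
    and charge: "\<And>d t. 1 \<le> t \<Longrightarrow> t \<le> d \<Longrightarrow> 2 ^ k \<le> 2 ^ (d - t) * (1 + 3 * t) \<Longrightarrow>
      4 \<le> d \<and> r * t + q \<le> p * d"
  shows "inversion_diameter G \<le> enat k"
proof (rule inversion_diameter_le[OF G(1)])
  fix \<pi> :: "'a \<Rightarrow> 'a \<Rightarrow> bool" assume \<pi>: "\<And>x y. \<pi> x y = \<pi> y x"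
  show "\<exists>f. dot_labelling k (parcs G) \<pi> f"
  proof (rule sparse_dot_labelling[OF _ _ _ \<pi> _ _ k q charge])
    note arcs = pair_graph_arcs[OF G(1)]
    show fin: "finite (parcs G)" "sym (parcs G)" "irrefl (parcs G)" by (fact arcs)+
    show "(z, x) \<notin> parcs G" if "(x, y) \<in> parcs G" "(y, z) \<in> parcs G" for x y z
    proof
      assume zx: "(z, x) \<in> parcs G"
      have "distinct [x, y, z]" using that zx arcs(3) unfolding irrefl_def by auto
      then have "girth G \<le> enat (length [x, y, z])"
        using that zx by (intro girth_le_length[OF pair_graph_wf[OF G(1)]]) auto
      with g(2) have "enat g \<le> enat (length [x, y, z])" by (rule order_trans)
      then show False using g(1) by simp
    qed
    fix E assume E: "E \<subseteq> parcs G" "sym E" "E \<noteq> {}"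
    then have "0 < card (fst ` E)" using fin(1) finite_subset[OF E(1)] by (simp add: card_gt_0_iff)
    then show "p * card E < q * card (fst ` E)"
      using density planar_sparse[OF G g(2) E] by blast
  qed
qed

text \<open>From \<open>d = 10\<close> on, \<open>t \<le> d\<close> suffices; the finitely many
  smaller cases are evaluated.\<close>

lemma charge_7:
  fixes d t :: nat
  assumes "1 \<le> t" "t \<le> d" "2 ^ 7 \<le> 2 ^ (d - t) * (1 + 3 * t)"
  shows "4 \<le> d \<and> 2 * t + 10 \<le> 3 * d"
proof (cases "10 \<le> d")
  case False
  have "t = 1 \<or> t = 2 \<or> t = 3 \<or> t = 4 \<or> t = 5 \<or> t = 6 \<or> t = 7 \<or> t = 8 \<or> t = 9"
    using assms False by linarith
  moreover have "d = 1 \<or> d = 2 \<or> d = 3 \<or> d = 4 \<or> d = 5 \<or> d = 6 \<or> d = 7 \<or> d = 8 \<or> d = 9"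
    using assms False by linarith
  ultimately show ?thesis using assms by (elim disjE) simp_all
qed (use assms in linarith)

text \<open>Here \<open>t \<le> d\<close> suffices from \<open>d = 6\<close> on. The product
  \<open>1 * t\<close> keeps the shape \<open>r * t\<close> required by the discharging.\<close>

lemma charge_5:
  fixes d t :: nat
  assumes "1 \<le> t" "t \<le> d" "2 ^ 5 \<le> 2 ^ (d - t) * (1 + 3 * t)"
  shows "4 \<le> d \<and> 1 * t + 6 \<le> 2 * d"
proof (cases "6 \<le> d")
  case False
  have "t = 1 \<or> t = 2 \<or> t = 3 \<or> t = 4 \<or> t = 5"
    using assms False by linarith
  moreover have "d = 1 \<or> d = 2 \<or> d = 3 \<or> d = 4 \<or> d = 5"
    using assms False by linarith
  ultimately show ?thesis using assms by (elim disjE) simp_all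
qed (use assms in linarith)

theorem theorem4p9:
  fixes G :: "'a pair_pre_digraph"
  assumes "pair_graph G" and "planar G"
  shows "(girth G = 5 \<longrightarrow> inversion_diameter G \<le> 7) \<and>
         (girth G = 6 \<longrightarrow> inversion_diameter G \<le> 5)"
proof (intro conjI impI)
  assume "girth G = 5"
  \<comment> \<open>Girth 5 gives average degree below 10/3, hence the charge 3 d - 10. A vertex of
    degree 2 lacks 4 and receives 2 from each of its neighbours.\<close>
  then have "inversion_diameter G \<le> enat 7"
    by (intro planar_inversion_diameter_le[OF assms, of 5 3 10 7 2] charge_7) (auto simp: numeral_eq_enat)
  then show "inversion_diameter G \<le> 7" by (simp add: numeral_eq_enat)
next
  assume "girth G = 6"
  \<comment> \<open>Girth 6 gives average degree below 3. The charge d - 3 is doubled to 2 d - 6, so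
    that the amount a vertex of degree 2 needs from each neighbour is the integer 1.\<close>
  then have "inversion_diameter G \<le> enat 5"
    by (intro planar_inversion_diameter_le[OF assms, of 6 2 6 5 1] charge_5) (auto simp: numeral_eq_enat)
  then show "inversion_diameter G \<le> 5" by (simp add: numeral_eq_enat)
qed

end
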